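(* Let $r>0$ and $\kappa<\infty$ be fixed, and let $(\phi_j)_{j\ge1}$ be the trigonometric basis. Then for any $\beta\ge1$ $$\liminf_{n\to\infty}\ \inf_{\widetilde S_n}\ \mathcal R_n(\widetilde S_n,\beta)>0,$$ where the infimum is over all estimators $\widetilde S_n$, i.e. all measurable functions of the observations $(y_t)_{0\le t\le n}$.
   Context: Model: $dy_t=S(t)\,dt+d\xi_t$, $0\le t\le n$, where $S$ is an unknown $1$-periodic function and the noise $(\xi_t)_{t\ge0}$ is a continuous zero-mean Gaussian process such that $\int_0^nf(t)\,d\xi_t$ is well defined (and linear in $f$) for all non-random $f\in L_2[0,n]$, $n\ge1$. $\mathcal X$ is the Hilbert space of square integrable $1$-periodic functions on $\mathbb R$ with $(x,y)=\int_0^1x(t)y(t)\,dt$ and $\|x\|^2=(x,x)$. Trigonometric basis: $\phi_1\equiv1$, and for $j\ge2$, $\phi_j(x)=\sqrt2\,\mathrm{Tr}_j(2\pi[j/2]x)$, where $\mathrm{Tr}_j(x)=\cos x$ for even $j$, $\mathrm{Tr}_j(x)=\sin x$ for odd $j$, and $[a]$ is the integer part of $a$. Functional class: $$\Theta_{\beta,r}=\Big\{S\in\mathcal C(\mathbb R)\cap\mathcal X:\ \max_{n\ge1}n^{2\beta}\varsigma_n(S)\le r^2\Big\},\qquad \varsigma_n(S)=\sum_{j=n}^\infty s_j^2,\quad s_j=(S,\phi_j),$$ where $\mathcal C(\mathbb R)$ is the set of continuous functions $\mathbb R\to\mathbb R$. Noise class: $\mathcal P_\kappa$ is some class of distributions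 $Q$ on $\mathbf C[0,+\infty)$ of the noise process. It contains the Wiener distribution $Q_0$. For every $Q\in\mathcal P_\kappa$: for all $n,k\ge1$ the vector with components $\zeta_j(n)=\frac1{\sqrt n}\int_0^n\phi_j(t)\,d\xi_t$, $1\le j\le k$, is Gaussian with non-degenerate covariance matrix $B_{k,n}$, and $\sup_{k\ge1}\sup_{n\ge1}\lambda_{\max}(B_{k,n})\le\lambda^*(Q)\le\kappa$, where $\lambda_{\max}$ is the maximal eigenvalue. Risk: $$\mathcal R_n(\widetilde S_n,\beta)=\sup_{S\in\Theta_{\beta,r}}\sup_{Q\in\mathcal P_\kappa}\mathbf E_{S,Q}\|\omega_n(\widetilde S_n-S)\|^2,\qquad \omega_n=n^{\frac{\beta}{2\beta+1}},$$ where $\mathbf E_{S,Q}$ is the expectation under the law of $y$ when the noise has distribution $Q$. *)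

theory Defs
  imports
    "HOL-Probability.Probability"
    "Jordan_Normal_Form.Char_Poly"
begin

definition sq_integrable :: "real set \<Rightarrow> (real \<Rightarrow> real) \<Rightarrow> bool" where
  "sq_integrable I f \<longleftrightarrow>
     f \<in> borel_measurable (lebesgue_on I) \<and> integrable (lebesgue_on I) (\<lambda>t. (f t)\<^sup>2)"

text \<open>Elements are functions, not classes modulo null sets, so \<open>X_norm\<close> is a seminorm; the open
  sets of \<open>X_borel\<close> are saturated for almost everywhere equality, so \<open>X_borel\<close> is the Borel
  \<open>\<sigma>\<close>-algebra of the Hilbert space.\<close>

definition X_space :: "(real \<Rightarrow> real) set" where
  "X_space = {f. (\<forall>t. f (t + 1) = f t) \<and> sq_integrable {0..1} f}"

definition X_inner :: "(real \<Rightarrow> real) \<Rightarrow> (real \<Rightarrow> real) \<Rightarrow> real" where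
  "X_inner f g = (LINT t|lebesgue_on {0..1}. f t * g t)"

definition X_norm :: "(real \<Rightarrow> real) \<Rightarrow> real" where
  "X_norm f = sqrt (X_inner f f)"

definition X_borel :: "(real \<Rightarrow> real) measure" where
  "X_borel = sigma X_space
     {U. U \<subseteq> X_space \<and>
         (\<forall>f\<in>U. \<exists>\<epsilon>>0. \<forall>g\<in>X_space. X_norm (\<lambda>t. g t - f t) < \<epsilon> \<longrightarrow> g \<in> U)}"

definition Tr :: "nat \<Rightarrow> real \<Rightarrow> real" where
  "Tr j x = (if even j then cos x else sin x)"

definition trig_basis :: "nat \<Rightarrow> real \<Rightarrow> real" where
  "trig_basis j x = (if j = 1 then 1 else sqrt 2 * Tr j (2 * pi * real (j div 2) * x))"

definition fourier_tail :: "nat \<Rightarrow> (real \<Rightarrow> real) \<Rightarrow> ennreal" where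
  "fourier_tail n S = (\<Sum>i. ennreal ((X_inner S (trig_basis (n + i)))\<^sup>2))"

definition Theta :: "real \<Rightarrow> real \<Rightarrow> (real \<Rightarrow> real) set" where
  "Theta \<beta> r = {S \<in> X_space. continuous_on UNIV S \<and>
     (SUP n\<in>{1..}. ennreal (real n powr (2 * \<beta>)) * fourier_tail n S) \<le> ennreal (r\<^sup>2)}"

text \<open>Continuous paths on \<open>I\<close> (undefined outside \<open>I\<close>) with the \<open>\<sigma>\<close>-algebra generated by the
  coordinate maps.\<close>

definition path_space :: "real set \<Rightarrow> (real \<Rightarrow> real) measure" where
  "path_space I = restrict_space (PiM I (\<lambda>_. borel)) {x. continuous_on I x}"

text \<open>Degenerate (almost surely constant) variables count as Gaussian.\<close>

definition gaussian_var :: "'a measure \<Rightarrow> ('a \<Rightarrow> real) \<Rightarrow> bool" where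
  "gaussian_var M X \<longleftrightarrow> X \<in> borel_measurable M \<and>
     ((\<exists>\<mu>. AE \<omega> in M. X \<omega> = \<mu>) \<or>
      (\<exists>\<mu> \<sigma>. \<sigma> > 0 \<and> distributed M lborel X (normal_density \<mu> \<sigma>)))"

definition gaussian_family :: "'a measure \<Rightarrow> 'i set \<Rightarrow> ('i \<Rightarrow> 'a \<Rightarrow> real) \<Rightarrow> bool" where
  "gaussian_family M I X \<longleftrightarrow>
     (\<forall>J c. finite J \<and> J \<subseteq> I \<longrightarrow> gaussian_var M (\<lambda>\<omega>. \<Sum>j\<in>J. c j * X j \<omega>))"

text \<open>A step function on \<open>[0,n]\<close> is a list of triples \<open>(a, b, c)\<close> standing for the sum of the
  \<open>c \<cdot> 1\<^bsub>(a,b]\<^esub>\<close>.\<close>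

definition step_on :: "nat \<Rightarrow> (real \<times> real \<times> real) list \<Rightarrow> bool" where
  "step_on n s \<longleftrightarrow> (\<forall>(a, b, c)\<in>set s. 0 \<le> a \<and> a \<le> b \<and> b \<le> real n)"

definition step_fun :: "(real \<times> real \<times> real) list \<Rightarrow> real \<Rightarrow> real" where
  "step_fun s t = (\<Sum>(a, b, c)\<leftarrow>s. c * indicator {a<..b} t)"

definition step_int :: "(real \<times> real \<times> real) list \<Rightarrow> (real \<Rightarrow> real) \<Rightarrow> real" where
  "step_int s x = (\<Sum>(a, b, c)\<leftarrow>s. c * (x b - x a))"

text \<open>The stochastic integral of a non-random \<open>f\<close> over \<open>[0,n]\<close> is the mean square limit of the
  integrals of step functions approximating \<open>f\<close> in \<open>L\<^sub>2[0,n]\<close>; the limit must not depend on the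
  approximating sequence. It is unique up to \<open>Q\<close>-null sets, and \<open>stoch_int\<close> selects a version.\<close>

definition is_stoch_int ::
    "(real \<Rightarrow> real) measure \<Rightarrow> nat \<Rightarrow> (real \<Rightarrow> real) \<Rightarrow> ((real \<Rightarrow> real) \<Rightarrow> real) \<Rightarrow> bool" where
  "is_stoch_int Q n f Y \<longleftrightarrow> Y \<in> borel_measurable Q \<and>
     (\<forall>s. (\<forall>k. step_on n (s k)) \<and>
          (\<lambda>k. \<integral>\<^sup>+t. ennreal ((step_fun (s k) t - f t)\<^sup>2) \<partial>lebesgue_on {0..real n}) \<longlonglongrightarrow> 0 \<longrightarrow>
          (\<lambda>k. \<integral>\<^sup>+x. ennreal ((step_int (s k) x - Y x)\<^sup>2) \<partial>Q) \<longlonglongrightarrow> 0)"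

definition stoch_int ::
    "(real \<Rightarrow> real) measure \<Rightarrow> nat \<Rightarrow> (real \<Rightarrow> real) \<Rightarrow> (real \<Rightarrow> real) \<Rightarrow> real" where
  "stoch_int Q n f = (SOME Y. is_stoch_int Q n f Y)"

definition noise_distribution :: "(real \<Rightarrow> real) measure \<Rightarrow> bool" where
  "noise_distribution Q \<longleftrightarrow>
     prob_space Q \<and> sets Q = sets (path_space {0..}) \<and>
     gaussian_family Q {0..} (\<lambda>t x. x t) \<and>
     (\<forall>t\<ge>0. integrable Q (\<lambda>x. x t) \<and> (LINT x|Q. x t) = 0) \<and>
     (\<forall>n\<ge>1. \<forall>f. sq_integrable {0..real n} f \<longrightarrow> (\<exists>Y. is_stoch_int Q n f Y)) \<and>
     (\<forall>n\<ge>1. \<forall>f g a b. sq_integrable {0..real n} f \<longrightarrow> sq_integrable {0..real n} g \<longrightarrow>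
        (AE x in Q. stoch_int Q n (\<lambda>t. a * f t + b * g t) x
                    = a * stoch_int Q n f x + b * stoch_int Q n g x))"

definition wiener_distribution :: "(real \<Rightarrow> real) measure \<Rightarrow> bool" where
  "wiener_distribution Q \<longleftrightarrow>
     prob_space Q \<and> sets Q = sets (path_space {0..}) \<and>
     (AE x in Q. x 0 = 0) \<and>
     (\<forall>s t. 0 \<le> s \<and> s < t \<longrightarrow>
        distributed Q lborel (\<lambda>x. x t - x s) (normal_density 0 (sqrt (t - s)))) \<and>
     (\<forall>\<tau> m. 0 \<le> \<tau> 0 \<and> strict_mono (\<tau> :: nat \<Rightarrow> real) \<longrightarrow>
        prob_space.indep_vars Q (\<lambda>_. borel) (\<lambda>i x. x (\<tau> (Suc i)) - x (\<tau> i)) {..<m})"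

definition zeta :: "(real \<Rightarrow> real) measure \<Rightarrow> nat \<Rightarrow> nat \<Rightarrow> (real \<Rightarrow> real) \<Rightarrow> real" where
  "zeta Q n j x = 1 / sqrt (real n) * stoch_int Q n (trig_basis j) x"

definition covar :: "'a measure \<Rightarrow> ('a \<Rightarrow> real) \<Rightarrow> ('a \<Rightarrow> real) \<Rightarrow> real" where
  "covar M X Y = (LINT \<omega>|M. (X \<omega> - (LINT \<omega>'|M. X \<omega>')) * (Y \<omega> - (LINT \<omega>'|M. Y \<omega>')))"

text \<open>Matrix rows and columns count from \<open>0\<close>, the basis from \<open>1\<close>.\<close>

definition cov_mat :: "(real \<Rightarrow> real) measure \<Rightarrow> nat \<Rightarrow> nat \<Rightarrow> real mat" where
  "cov_mat Q k n = mat k k (\<lambda>(i, j). covar Q (zeta Q n (Suc i)) (zeta Q n (Suc j)))"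

definition lambda_max :: "real mat \<Rightarrow> real" where
  "lambda_max A = Max {e. eigenvalue A e}"

text \<open>The law of \<open>y\<^sub>t = \<integral>\<^sub>0\<^sup>t S(u) du + \<xi>\<^sub>t\<close>, \<open>t \<ge> 0\<close>, where \<open>\<xi>\<close> has distribution \<open>Q\<close>.\<close>

definition obs_law :: "(real \<Rightarrow> real) \<Rightarrow> (real \<Rightarrow> real) measure \<Rightarrow> (real \<Rightarrow> real) measure" where
  "obs_law S Q = distr Q (path_space {0..}) (\<lambda>\<xi>. \<lambda>t\<in>{0..}. integral {0..t} S + \<xi> t)"

definition estimators :: "nat \<Rightarrow> ((real \<Rightarrow> real) \<Rightarrow> (real \<Rightarrow> real)) set" where
  "estimators n = path_space {0..real n} \<rightarrow>\<^sub>M X_borel"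

definition omega :: "real \<Rightarrow> nat \<Rightarrow> real" where
  "omega \<beta> n = real n powr (\<beta> / (2 * \<beta> + 1))"

definition risk ::
    "(real \<Rightarrow> real) measure set \<Rightarrow> real \<Rightarrow> real \<Rightarrow> nat \<Rightarrow> ((real \<Rightarrow> real) \<Rightarrow> (real \<Rightarrow> real)) \<Rightarrow> ennreal"
  where
  "risk P r \<beta> n T = (SUP S\<in>Theta \<beta> r. SUP Q\<in>P.
     \<integral>\<^sup>+y. ennreal ((X_norm (\<lambda>t. omega \<beta> n * (T (restrict y {0..real n}) t - S t)))\<^sup>2)
        \<partial>obs_law S Q)"

end

theory Submission
  imports Defs
begin

text \<open>Assouad's lemma is applied under the Wiener law \<open>Q\<^sub>0\<close> to the cube of
  signals \<open>S\<^sub>J = (\<Sum>j\<in>J. \<delta> \<phi>\<^sub>j)\<close>, \<open>J \<subseteq> {1..m}\<close>, with \<open>\<delta> = r n\<^bsup>-1/2\<^esup>\<close> and \<open>m\<close> the integer part of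
  \<open>n\<^bsup>1/(2\<beta>+1)\<^esup>\<close>; then \<open>m\<^bsup>2\<beta>+1\<^esup> \<delta>\<^sup>2 \<le> r\<^sup>2\<close> puts the cube inside the class. Adding one index to \<open>J\<close>
  changes the drift by at most \<open>\<delta> \<surd>2\<close>, so the two laws of the observation satisfy
  \<open>P\<^sub>1(A)\<^sup>2 \<le> exp (2 r\<^sup>2) P\<^sub>0(A)\<close>, and no test can recover the coordinate. Hence each of the \<open>m\<close>
  coordinates costs a multiple of \<open>\<delta>\<^sup>2\<close>, and \<open>\<omega>\<^sub>n\<^sup>2 m \<delta>\<^sup>2\<close> stays away from zero.

  The inequality between the laws is proved without Girsanov's theorem: the increments over a dyadic
  grid are independent Gaussian, where it is Cauchy--Schwarz with a constant that does not depend on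
  the grid, and it passes from the algebra of dyadic cylinder sets to the \<open>\<sigma>\<close>-algebra by approximation.\<close>

section \<open>Gaussian product measures\<close>

text \<open>Cauchy--Schwarz for \<open>F\<close> against the likelihood ratio of the two normal
  laws. The constant is the second moment of that ratio under the law centred at \<open>b\<close>,
  that is, one plus the chi-square divergence.\<close>

lemma nn_integral_normal_sq_le:
  fixes F :: "real \<Rightarrow> ennreal"
  assumes \<sigma>: "\<sigma> > 0" and [measurable]: "F \<in> borel_measurable borel"
  shows "(\<integral>\<^sup>+x. F x \<partial>density lborel (normal_density a \<sigma>))\<^sup>2
    \<le> ennreal (exp ((a - b)\<^sup>2 / \<sigma>\<^sup>2)) * (\<integral>\<^sup>+x. (F x)\<^sup>2 \<partial>density lborel (normal_density b \<sigma>))"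
proof -
  define N where "N = density lborel (\<lambda>x. ennreal (normal_density b \<sigma> x))"
  \<comment> \<open>\<open>L\<close> is the density of the normal law centred at \<open>a\<close>
    with respect to the one centred at \<open>b\<close>.\<close>
  define L where "L x = exp ((a - b) * (x - b) / \<sigma>\<^sup>2 - (a - b)\<^sup>2 / (2 * \<sigma>\<^sup>2))" for x
  have [measurable]: "L \<in> borel_measurable borel" unfolding L_def by measurable
  have [measurable_cong, simp]: "sets N = sets borel" by (simp add: N_def)
  have La: "normal_density a \<sigma> x = normal_density b \<sigma> x * L x" for x
  proof -
    have "- (x - a)\<^sup>2 / (2 * \<sigma>\<^sup>2)
        = - (x - b)\<^sup>2 / (2 * \<sigma>\<^sup>2) + ((a - b) * (x - b) / \<sigma>\<^sup>2 - (a - b)\<^sup>2 / (2 * \<sigma>\<^sup>2))"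
      using \<sigma> by (simp add: field_simps power2_eq_square)
    then show ?thesis unfolding normal_density_def L_def mult.assoc exp_add[symmetric] by simp
  qed
  \<comment> \<open>Completing the square turns the weighted square of \<open>L\<close> into a
    multiple of the normal density centred at \<open>2 * a - b\<close>, so its integral can be read
    off.\<close>
  have LL: "normal_density b \<sigma> x * (L x)\<^sup>2
      = exp ((a - b)\<^sup>2 / \<sigma>\<^sup>2) * normal_density (2 * a - b) \<sigma> x" for x
  proof -
    have "- (x - b)\<^sup>2 / (2 * \<sigma>\<^sup>2) + 2 * ((a - b) * (x - b) / \<sigma>\<^sup>2 - (a - b)\<^sup>2 / (2 * \<sigma>\<^sup>2))
        = (a - b)\<^sup>2 / \<sigma>\<^sup>2 + - (x - (2 * a - b))\<^sup>2 / (2 * \<sigma>\<^sup>2)"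
      using \<sigma> by (simp add: field_simps power2_eq_square)
    then have "exp (- (x - b)\<^sup>2 / (2 * \<sigma>\<^sup>2)) * (L x)\<^sup>2
        = exp ((a - b)\<^sup>2 / \<sigma>\<^sup>2) * exp (- (x - (2 * a - b))\<^sup>2 / (2 * \<sigma>\<^sup>2))"
      unfolding L_def exp_double[symmetric] exp_add[symmetric] by simp
    then show ?thesis unfolding normal_density_def by simp
  qed
  have "(\<integral>\<^sup>+x. F x \<partial>density lborel (normal_density a \<sigma>))
      = (\<integral>\<^sup>+x. F x * ennreal (L x) \<partial>N)"
    unfolding N_def
    by (auto simp: nn_integral_density La ennreal_mult' ac_simps L_def intro!: nn_integral_cong)
  then have "(\<integral>\<^sup>+x. F x \<partial>density lborel (normal_density a \<sigma>))\<^sup>2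
      \<le> (\<integral>\<^sup>+x. (F x)\<^sup>2 \<partial>N) * (\<integral>\<^sup>+x. (ennreal (L x))\<^sup>2 \<partial>N)"
    by (simp add: Cauchy_Schwarz_nn_integral)
  also have "(\<integral>\<^sup>+x. (ennreal (L x))\<^sup>2 \<partial>N)
      = (\<integral>\<^sup>+x. ennreal (exp ((a - b)\<^sup>2 / \<sigma>\<^sup>2)) * ennreal (normal_density (2 * a - b) \<sigma> x) \<partial>lborel)"
    unfolding N_def
    by (auto simp: nn_integral_density ennreal_power L_def ennreal_mult'[symmetric] LL[unfolded L_def]
        intro!: nn_integral_cong)
  also have "\<dots> = ennreal (exp ((a - b)\<^sup>2 / \<sigma>\<^sup>2))"
    by (simp add: nn_integral_cmult nn_integral_eq_integral integral_normal_density[OF \<sigma>] integrable_normal_density[OF \<sigma>])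
  finally show ?thesis by (simp add: N_def mult.commute)
qed

text \<open>The inequality tensorizes, with the constants multiplying: split off one coordinate by
  Fubini and use induction for the others. It is stated for all nonnegative measurable
  \<open>F\<close>, not only for indicators, because integrating out a coordinate of an indicator
  leaves a general function.\<close>

lemma nn_integral_PiM_sq_le:
  fixes A B :: "'i \<Rightarrow> 'a measure" and K :: "'i \<Rightarrow> ennreal"
  assumes "finite I"
    and A: "\<And>i. prob_space (A i)" and B: "\<And>i. prob_space (B i)"
    and s: "\<And>i. sets (A i) = sets (B i)"
    and le: "\<And>i (F :: 'a \<Rightarrow> ennreal). i \<in> I \<Longrightarrow> F \<in> borel_measurable (B i) \<Longrightarrow>
        (\<integral>\<^sup>+x. F x \<partial>A i)\<^sup>2 \<le> K i * (\<integral>\<^sup>+x. (F x)\<^sup>2 \<partial>B i)"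
    and F: "F \<in> borel_measurable (PiM I B)"
  shows "(\<integral>\<^sup>+x. F x \<partial>PiM I A)\<^sup>2 \<le> (\<Prod>i\<in>I. K i) * (\<integral>\<^sup>+x. (F x)\<^sup>2 \<partial>PiM I B)"
  using assms(1) le F
proof (induction I arbitrary: F rule: finite_induct)
  case empty
  show ?case
    by (simp add: PiM_empty nn_integral_count_space_finite)
next
  case (insert i I)
  interpret A: product_sigma_finite A
    by (simp add: product_sigma_finite_def prob_space_imp_sigma_finite A)
  interpret B: product_sigma_finite B
    by (simp add: product_sigma_finite_def prob_space_imp_sigma_finite B)
  have PP: "sets (PiM J A) = sets (PiM J B)" for J
    by (rule sets_PiM_cong) (simp_all add: s)
  have [measurable_cong]: "sets (A i) = sets (B i)" by (rule s)
  note [measurable] = insert.prems(2)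
  have FA: "F \<in> borel_measurable (PiM (insert i I) A)"
    using insert.prems(2) by (simp add: measurable_cong_sets[OF PP refl])
  have upd[measurable]: "(\<lambda>(x, y). x(i := y)) \<in> PiM I B \<Otimes>\<^sub>M B i \<rightarrow>\<^sub>M PiM (insert i I) B"
    by (simp add: measurable_add_dim)
  have pm[measurable]: "(\<lambda>(x, y). F (x(i := y))) \<in> borel_measurable (PiM I B \<Otimes>\<^sub>M B i)"
    using measurable_compose[OF upd insert.prems(2)] by (simp add: split_beta')
  have sec: "(\<lambda>y. F (x(i := y))) \<in> borel_measurable (B i)" if "x \<in> space (PiM I B)" for x
    using measurable_Pair2[OF pm that] by simp
  have G[measurable]: "(\<lambda>x. \<integral>\<^sup>+y. F (x(i := y)) \<partial>A i) \<in> borel_measurable (PiM I B)"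
    by (rule sigma_finite_measure.borel_measurable_nn_integral[OF prob_space_imp_sigma_finite[OF A]]) (simp add: measurable_cong_sets[OF sets_pair_measure_cong[OF refl s]] pm)
  have G2[measurable]: "(\<lambda>x. \<integral>\<^sup>+y. (F (x(i := y)))\<^sup>2 \<partial>B i) \<in> borel_measurable (PiM I B)"
    by (rule sigma_finite_measure.borel_measurable_nn_integral[OF prob_space_imp_sigma_finite[OF B]]) measurable
  have "(\<integral>\<^sup>+x. F x \<partial>PiM (insert i I) A)\<^sup>2 = (\<integral>\<^sup>+x. (\<integral>\<^sup>+y. F (x(i := y)) \<partial>A i) \<partial>PiM I A)\<^sup>2"
    by (subst A.product_nn_integral_insert[OF insert.hyps FA]) simp
  \<comment> \<open>The induction hypothesis is applied to the inner integral as a function of the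
    remaining coordinates; the one-coordinate inequality is then used pointwise under the outer
    integral.\<close>
  also have "\<dots> \<le> (\<Prod>i\<in>I. K i) * (\<integral>\<^sup>+x. (\<integral>\<^sup>+y. F (x(i := y)) \<partial>A i)\<^sup>2 \<partial>PiM I B)"
    using insert.prems(1) by (intro insert.IH G) auto
  also have "\<dots> \<le> (\<Prod>i\<in>I. K i) * (\<integral>\<^sup>+x. K i * (\<integral>\<^sup>+y. (F (x(i := y)))\<^sup>2 \<partial>B i) \<partial>PiM I B)"
    using insert.prems(1) sec by (intro mult_left_mono nn_integral_mono) auto
  also have "\<dots> = (\<Prod>i\<in>insert i I. K i) * (\<integral>\<^sup>+x. (F x)\<^sup>2 \<partial>PiM (insert i I) B)"
    using insert.hyps by (simp add: nn_integral_cmult B.product_nn_integral_insert ac_simps)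
  finally show ?case .
qed

section \<open>Approximation by sets of an algebra\<close>

text \<open>Induction over the generation of the \<open>\<sigma>\<close>-algebra: complements keep
  the symmetric difference, and a countable union is cut to a finite one. A single \<open>C\<close>
  has to serve both measures, since the inequality to be transferred compares them on the same
  set.\<close>

lemma sigma_sets_approx:
  fixes M N :: "'a measure"
  assumes "finite_measure M" "finite_measure N"
    and alg: "Sigma_Algebra.algebra \<Omega> G" and sM: "sets M = sigma_sets \<Omega> G" and sN: "sets N = sigma_sets \<Omega> G"
    and A: "A \<in> sigma_sets \<Omega> G" and e: "e > 0"
  shows "\<exists>C\<in>G. measure M (sym_diff A C) < e \<and> measure N (sym_diff A C) < e"
  using A e
proof (induction arbitrary: e rule: sigma_sets.induct)
  interpret Sigma_Algebra.algebra \<Omega> G by fact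
  case (Basic a) then show ?case by (auto intro!: bexI[of _ a])
next
  interpret Sigma_Algebra.algebra \<Omega> G by fact
  case Empty then show ?case by (auto intro!: bexI[of _ "{}"])
next
  interpret Sigma_Algebra.algebra \<Omega> G by fact
  case (Compl a)
  then obtain C where C: "C \<in> G" "measure M (sym_diff a C) < e" "measure N (sym_diff a C) < e"
    by blast
  have "a \<subseteq> \<Omega>" using Compl(1) sigma_sets_into_sp[OF space_closed] by auto
  moreover have "C \<subseteq> \<Omega>" using C(1) space_closed by auto
  ultimately have "sym_diff (\<Omega> - a) (\<Omega> - C) = sym_diff a C" by auto
  then show ?case using C by (intro bexI[of _ "\<Omega> - C"]) auto
next
  interpret Sigma_Algebra.algebra \<Omega> G by fact
  case (Union a)
  interpret M: finite_measure M by fact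
  interpret N: finite_measure N by fact
  define U where "U k = (\<Union>i<k. a i)" for k :: nat
  have aM: "a i \<in> sets M" and aN: "a i \<in> sets N" for i using Union.hyps sM sN by auto
  have tail: "(\<lambda>k. measure M' ((\<Union>i. a i) - U k)) \<longlonglongrightarrow> 0"
    if "finite_measure M'" and s: "\<And>i. a i \<in> sets M'" for M' :: "'a measure"
  proof -
    interpret M': finite_measure M' by fact
    have "(\<lambda>k. measure M' ((\<Union>i. a i) - U k)) \<longlonglongrightarrow> measure M' (\<Inter>k. (\<Union>i. a i) - U k)"
      using s by (intro M'.finite_Lim_measure_decseq) (auto simp: decseq_def U_def)
    moreover have "(\<Inter>k. (\<Union>i. a i) - U k) = {}" by (auto simp: U_def)
    ultimately show ?thesis by (simp only: measure_empty)
  qed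
  from Union.prems have e2: "e / 2 > 0" by simp
  have "eventually (\<lambda>k. measure M ((\<Union>i. a i) - U k) < e / 2 \<and> measure N ((\<Union>i. a i) - U k) < e / 2)
      sequentially"
    using order_tendstoD(2)[OF tail e2, of M] order_tendstoD(2)[OF tail e2, of N] aM aN assms(1,2)
    by (auto simp: eventually_conj_iff)
  then obtain k where k: "measure M ((\<Union>i. a i) - U k) < e / 2" "measure N ((\<Union>i. a i) - U k) < e / 2"
    by (auto dest: eventually_happens)
  \<comment> \<open>Half of \<open>e\<close> is spent on the tail of the union; the other half is
    shared by the first \<open>k\<close> sets. The \<open>+ 1\<close> keeps the tolerance meaningful
    for \<open>k = 0\<close>.\<close>
  have "\<exists>C\<in>G. measure M (sym_diff (a i) C) < e / (2 * (real k + 1)) \<and>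
      measure N (sym_diff (a i) C) < e / (2 * (real k + 1))" for i
    using Union.prems by (intro Union.IH) auto
  then obtain C where CG: "\<And>i. C i \<in> G"
    and C: "\<And>i. measure M (sym_diff (a i) (C i)) < e / (2 * (real k + 1))"
      "\<And>i. measure N (sym_diff (a i) (C i)) < e / (2 * (real k + 1))"
    by metis
  define D where "D = (\<Union>i<k. C i)"
  have DG: "D \<in> G" unfolding D_def using CG by auto
  have est: "measure M' (sym_diff (\<Union>i. a i) D) < e"
    if "finite_measure M'" and s: "\<And>i. a i \<in> sets M'" and sC: "\<And>i. C i \<in> sets M'"
      and 1: "measure M' ((\<Union>i. a i) - U k) < e / 2"
      and 2: "\<And>i. measure M' (sym_diff (a i) (C i)) < e / (2 * (real k + 1))" for M' :: "'a measure"
  proof -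
    interpret M': finite_measure M' by fact
    have "sym_diff (\<Union>i. a i) D \<subseteq> ((\<Union>i. a i) - U k) \<union> (\<Union>i<k. sym_diff (a i) (C i))"
      by (auto simp: D_def U_def)
    then have "measure M' (sym_diff (\<Union>i. a i) D)
        \<le> measure M' (((\<Union>i. a i) - U k) \<union> (\<Union>i<k. sym_diff (a i) (C i)))"
      using s sC by (intro M'.finite_measure_mono) (auto simp: U_def)
    also have "\<dots> \<le> measure M' ((\<Union>i. a i) - U k) + measure M' (\<Union>i<k. sym_diff (a i) (C i))"
      using s sC by (intro measure_Un_le) (auto simp: U_def)
    also have "measure M' (\<Union>i<k. sym_diff (a i) (C i)) \<le> (\<Sum>i<k. measure M' (sym_diff (a i) (C i)))"
      using s sC by (intro measure_UNION_le) auto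
    also have "\<dots> \<le> (\<Sum>i<k. e / (2 * (real k + 1)))"
      using 2 by (intro sum_mono) (simp add: less_imp_le)
    also have "\<dots> \<le> e / 2" using e2 by (simp add: field_simps)
    finally show ?thesis using 1 by simp
  qed
  show ?case
    using DG k C CG aM aN assms(1,2) sM sN
    by (intro bexI[of _ D] conjI est) auto
qed

text \<open>Replace \<open>A\<close> by a close set \<open>C\<close> of the algebra. Squaring has
  Lipschitz constant 2 on probabilities, so both sides of the inequality are stable under the
  replacement.\<close>

lemma measure_sq_le_sigma_sets:
  fixes M N :: "'a measure"
  assumes M: "prob_space M" and N: "prob_space N"
    and alg: "Sigma_Algebra.algebra \<Omega> G" and sM: "sets M = sigma_sets \<Omega> G" and sN: "sets N = sigma_sets \<Omega> G"
    and le: "\<And>C. C \<in> G \<Longrightarrow> (measure M C)\<^sup>2 \<le> K * measure N C" and K: "K \<ge> 0"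
    and A: "A \<in> sigma_sets \<Omega> G"
  shows "(measure M A)\<^sup>2 \<le> K * measure N A"
proof (rule field_le_epsilon)
  fix e :: real assume e: "e > 0"
  interpret M: prob_space M by fact
  interpret N: prob_space N by fact
  \<comment> \<open>The replacement costs \<open>2 * d\<close> on the left and \<open>K * d\<close>
    on the right, which together make \<open>e\<close>.\<close>
  define d where "d = e / (2 + K)"
  have d: "d > 0" using e K by (simp add: d_def)
  obtain C where C: "C \<in> G" "measure M (sym_diff A C) < d" "measure N (sym_diff A C) < d"
    using sigma_sets_approx[OF _ _ alg sM sN A d] M.finite_measure_axioms N.finite_measure_axioms by blast
  have CM: "C \<in> sets M" "C \<in> sets N" "A \<in> sets M" "A \<in> sets N" using C A sM sN by auto
  have "measure M A \<le> measure M (C \<union> sym_diff A C)"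
    using CM by (intro M.finite_measure_mono) auto
  also have "\<dots> \<le> measure M C + measure M (sym_diff A C)"
    using CM by (intro measure_Un_le) auto
  finally have 1: "measure M A \<le> measure M C + d" using C by simp
  have "measure N C \<le> measure N (A \<union> sym_diff A C)"
    using CM by (intro N.finite_measure_mono) auto
  also have "\<dots> \<le> measure N A + measure N (sym_diff A C)"
    using CM by (intro measure_Un_le) auto
  finally have 2: "measure N C \<le> measure N A + d" using C by simp
  have "(measure M A)\<^sup>2 \<le> (measure M C)\<^sup>2 + 2 * d"
  proof (cases "measure M A \<le> measure M C")
    case True
    then have "(measure M A)\<^sup>2 \<le> (measure M C)\<^sup>2" by (intro power_mono) auto
    then show ?thesis using d by linarith
  next
    case False
    have "(measure M A)\<^sup>2 - (measure M C)\<^sup>2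
        = (measure M A - measure M C) * (measure M A + measure M C)"
      by (simp add: power2_eq_square algebra_simps)
    also have "\<dots> \<le> d * (1 + 1)"
      using False 1 d by (intro mult_mono add_mono) (auto)
    finally show ?thesis by simp
  qed
  also have "\<dots> \<le> K * measure N C + 2 * d" using le[OF C(1)] by simp
  also have "\<dots> \<le> K * (measure N A + d) + 2 * d" using 2 K by (simp add: mult_left_mono)
  also have "\<dots> = K * measure N A + d * (2 + K)" by (simp add: algebra_simps)
  also have "d * (2 + K) = e" using K by (simp add: d_def)
  finally show "(measure M A)\<^sup>2 \<le> K * measure N A + e" .
qed

section \<open>Dyadic cylinder sets of paths\<close>

lemma space_path_space: "space (path_space I) = {x \<in> extensional I. continuous_on I x}"
  by (auto simp: path_space_def space_restrict_space space_PiM PiE_def)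

lemma path_space_eval [measurable]: "t \<in> I \<Longrightarrow> (\<lambda>x. x t) \<in> borel_measurable (path_space I)"
  unfolding path_space_def by (intro measurable_restrict_space1) measurable

text \<open>Adding a drift and shortening the time interval are treated at once:
  \<open>J = I = {0..}\<close> serves the full observation, \<open>J = {0..T}\<close> the observed
  part, and \<open>H = 0\<close> plain restriction.\<close>

lemma path_space_shift_measurable:
  assumes "J \<subseteq> I" and H: "continuous_on J H"
  shows "(\<lambda>x. \<lambda>t\<in>J. H t + x t) \<in> path_space I \<rightarrow>\<^sub>M path_space J"
proof -
  have "continuous_on J (\<lambda>t\<in>J. H t + x t)" if "continuous_on I x" for x
    using continuous_on_add[OF H continuous_on_subset[OF that \<open>J \<subseteq> I\<close>]]
    by (subst continuous_on_cong[OF refl, of J _ "\<lambda>t. H t + x t"]) auto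
  then have "(\<lambda>x. \<lambda>t\<in>J. H t + x t) \<in> space (path_space I) \<rightarrow> {x. continuous_on J x}"
    by (auto simp: space_path_space)
  moreover have "(\<lambda>x. \<lambda>t\<in>J. H t + x t) \<in> path_space I \<rightarrow>\<^sub>M PiM J (\<lambda>_. borel)"
    using \<open>J \<subseteq> I\<close> by (intro measurable_restrict) auto
  ultimately show ?thesis
    unfolding path_space_def[of J] by (rule measurable_restrict_space2)
qed

lemma path_space_restrict_measurable:
  assumes "J \<subseteq> I"
  shows "(\<lambda>x. restrict x J) \<in> path_space I \<rightarrow>\<^sub>M path_space J"
  using path_space_shift_measurable[OF assms, of "\<lambda>_. 0"] by (simp add: restrict_def)

definition dyadic_vals :: "real \<Rightarrow> nat \<Rightarrow> (real \<Rightarrow> real) \<Rightarrow> nat \<Rightarrow> real" where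
  "dyadic_vals T k x = (\<lambda>i\<in>{..2 ^ k}. x (real i * T / 2 ^ k))"

text \<open>Cylinder sets over the level-\<open>k\<close> grid. As a \<open>vimage_algebra\<close>,
  each level is a \<open>\<sigma>\<close>-algebra by construction, and comparing levels becomes a
  question of measurability of \<open>dyadic_vals\<close>.\<close>

definition dyadic_sets :: "real \<Rightarrow> nat \<Rightarrow> (real \<Rightarrow> real) set set" where
  "dyadic_sets T k =
     sets (vimage_algebra (space (path_space {0..T})) (dyadic_vals T k) (PiM {..2 ^ k} (\<lambda>_. borel)))"

lemma dyadic_vals_in: "dyadic_vals T k \<in> \<Omega> \<rightarrow> space (PiM {..2 ^ k} (\<lambda>_. borel))"
  by (auto simp: dyadic_vals_def space_PiM)

lemma dyadic_sets_iff:
  "A \<in> dyadic_sets T k \<longleftrightarrow> (\<exists>E\<in>sets (PiM {..2 ^ k} (\<lambda>_. borel)).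
     A = dyadic_vals T k -` E \<inter> space (path_space {0..T}))"
  unfolding dyadic_sets_def by (subst sets_vimage_algebra2[OF dyadic_vals_in]) auto

lemma dyadic_time_in:
  assumes "T \<ge> 0" "i \<le> 2 ^ k"
  shows "real i * T / 2 ^ k \<in> {0..T}"
proof -
  have "real i \<le> 2 ^ k" using assms(2) by (metis of_nat_le_iff of_nat_numeral of_nat_power)
  then have "real i * T \<le> 2 ^ k * T" using assms(1) by (rule mult_right_mono)
  then show ?thesis using assms(1) by (simp add: field_simps)
qed

lemma dyadic_vals_measurable:
  assumes "T \<ge> 0"
  shows "dyadic_vals T k \<in> path_space {0..T} \<rightarrow>\<^sub>M PiM {..2 ^ k} (\<lambda>_. borel)"
  unfolding dyadic_vals_def using dyadic_time_in[OF assms]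
  by (intro measurable_restrict path_space_eval) auto

text \<open>The point \<open>i\<close> of the coarse grid is the point
  \<open>i * 2 ^ (l - k)\<close> of the fine one, so the coarse sample is a measurable function of
  the fine sample.\<close>

lemma dyadic_sets_mono:
  assumes "k \<le> l"
  shows "dyadic_sets T k \<subseteq> dyadic_sets T l"
proof -
  let ?\<Omega> = "space (path_space {0..T})"
  let ?V = "vimage_algebra ?\<Omega> (dyadic_vals T l) (PiM {..2 ^ l} (\<lambda>_. borel))"
  have le: "i * 2 ^ (l - k) \<le> 2 ^ l" if "i \<le> 2 ^ k" for i :: nat
  proof -
    have "i * 2 ^ (l - k) \<le> 2 ^ k * 2 ^ (l - k)" using that by (rule mult_right_mono) simp
    also have "\<dots> = 2 ^ l" using assms by (subst power_add[symmetric]) simp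
    finally show ?thesis .
  qed
  have l: "(2::real) ^ l = 2 ^ k * 2 ^ (l - k)" using assms by (subst power_add[symmetric]) simp
  have eq: "dyadic_vals T k x = (\<lambda>i\<in>{..2 ^ k}. dyadic_vals T l x (i * 2 ^ (l - k)))" for x
    unfolding dyadic_vals_def
  proof (rule restrict_ext)
    fix i :: nat assume "i \<in> {..2 ^ k}"
    then show "x (real i * T / 2 ^ k)
        = (\<lambda>i\<in>{..2 ^ l}. x (real i * T / 2 ^ l)) (i * 2 ^ (l - k))"
      using le[of i] unfolding l by simp
  qed
  have "(\<lambda>x. \<lambda>i\<in>{..2 ^ k}. dyadic_vals T l x (i * 2 ^ (l - k))) \<in> ?V \<rightarrow>\<^sub>M PiM {..2 ^ k} (\<lambda>_. borel)"
  proof (rule measurable_restrict)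
    fix i :: nat assume "i \<in> {..2 ^ k}"
    then have "i * 2 ^ (l - k) \<in> {..2 ^ l}" using le by simp
    then show "(\<lambda>x. dyadic_vals T l x (i * 2 ^ (l - k))) \<in> borel_measurable ?V"
      by (rule measurable_compose[OF measurable_vimage_algebra1[OF dyadic_vals_in] measurable_component_singleton])
  qed
  then have "dyadic_vals T k \<in> ?V \<rightarrow>\<^sub>M PiM {..2 ^ k} (\<lambda>_. borel)"
    unfolding eq[abs_def] .
  then show ?thesis
    unfolding measurable_iff_sets dyadic_sets_def space_vimage_algebra by (rule conjunct2)
qed

text \<open>An increasing union of \<open>\<sigma>\<close>-algebras: any two members already lie in
  a common level.\<close>

lemma algebra_dyadic_sets:
  "Sigma_Algebra.algebra (space (path_space {0..T})) (\<Union>k. dyadic_sets T k)"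
  unfolding algebra_iff_Un
proof (intro conjI ballI)
  let ?\<Omega> = "space (path_space {0..T})"
  let ?V = "\<lambda>k. vimage_algebra ?\<Omega> (dyadic_vals T k) (PiM {..2 ^ k} (\<lambda>_. borel))"
  show "(\<Union>k. dyadic_sets T k) \<subseteq> Pow ?\<Omega>"
    by (auto simp: dyadic_sets_iff)
  show "{} \<in> (\<Union>k. dyadic_sets T k)" by (auto simp: dyadic_sets_def)
  show "?\<Omega> - a \<in> (\<Union>k. dyadic_sets T k)" if "a \<in> (\<Union>k. dyadic_sets T k)" for a
  proof -
    from that obtain k where "a \<in> sets (?V k)" unfolding dyadic_sets_def by blast
    from sets.compl_sets[OF this] have "?\<Omega> - a \<in> dyadic_sets T k" by (simp add: dyadic_sets_def)
    then show ?thesis by blast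
  qed
  show "a \<union> b \<in> (\<Union>k. dyadic_sets T k)"
    if "a \<in> (\<Union>k. dyadic_sets T k)" "b \<in> (\<Union>k. dyadic_sets T k)" for a b
  proof -
    from that obtain i j where "a \<in> dyadic_sets T i" "b \<in> dyadic_sets T j" by auto
    then have "a \<in> dyadic_sets T (max i j)" "b \<in> dyadic_sets T (max i j)"
      using dyadic_sets_mono[of i "max i j" T] dyadic_sets_mono[of j "max i j" T] by auto
    then have "a \<union> b \<in> dyadic_sets T (max i j)" unfolding dyadic_sets_def by (rule sets.Un)
    then show ?thesis by blast
  qed
qed

text \<open>\<open>i k\<close> indexes the last grid point not after \<open>t\<close>; it misses
  \<open>t\<close> by less than the mesh \<open>T / 2 ^ k\<close>.\<close>

lemma dyadic_floor:
  assumes "T > 0" "t \<in> {0..T}"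
  defines "i \<equiv> \<lambda>k. nat \<lfloor>t * 2 ^ k / T\<rfloor>"
  shows "i k \<le> 2 ^ k" and "(\<lambda>k. real (i k) * T / 2 ^ k) \<longlonglongrightarrow> t"
proof -
  have nn: "t * 2 ^ k / T \<ge> 0" for k using assms by simp
  have bd: "real (i k) \<le> t * 2 ^ k / T" "t * 2 ^ k / T < real (i k) + 1" for k
    using nn[of k] unfolding i_def by linarith+
  have "t * 2 ^ k / T \<le> 2 ^ k" for k
    using assms by (simp add: field_simps)
  from order_trans[OF bd(1) this] show "i k \<le> 2 ^ k"
    by (metis of_nat_le_iff of_nat_numeral of_nat_power)
  show "(\<lambda>k. real (i k) * T / 2 ^ k) \<longlonglongrightarrow> t"
  proof (rule tendsto_sandwich)
    show "(\<lambda>k. t - T * (1 / 2) ^ k) \<longlonglongrightarrow> t"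
      using tendsto_diff[OF tendsto_const tendsto_mult[OF tendsto_const LIMSEQ_realpow_zero[of "1/2"]], of t T]
      by simp
    show "(\<lambda>k. t) \<longlonglongrightarrow> t" by simp
    show "eventually (\<lambda>k. t - T * (1 / 2) ^ k \<le> real (i k) * T / 2 ^ k) sequentially"
    proof (intro always_eventually allI)
      fix k
      have "t = (t * 2 ^ k / T) * (T / 2 ^ k)" using assms(1) by simp
      also have "\<dots> \<le> (real (i k) + 1) * (T / 2 ^ k)"
        using assms(1) bd(2)[of k] by (intro mult_right_mono) auto
      also have "\<dots> = real (i k) * T / 2 ^ k + T * (1 / 2) ^ k"
        by (simp add: algebra_simps power_one_over add_divide_distrib)
      finally show "t - T * (1 / 2) ^ k \<le> real (i k) * T / 2 ^ k" by simp
    qed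
    show "eventually (\<lambda>k. real (i k) * T / 2 ^ k \<le> t) sequentially"
      using bd(1) assms(1) by (intro always_eventually allI) (auto simp: field_simps)
  qed
qed

text \<open>By continuity, a path is determined measurably by its values at the dyadic times.\<close>

lemma sets_path_space_dyadic:
  assumes T: "T > 0"
  shows "sets (path_space {0..T}) = sigma_sets (space (path_space {0..T})) (\<Union>k. dyadic_sets T k)"
    (is "_ = sigma_sets ?\<Omega> ?G")
proof (rule equalityI)
  have "dyadic_sets T k \<subseteq> sets (path_space {0..T})" for k
    using dyadic_vals_measurable[OF less_imp_le[OF T], of k]
    unfolding measurable_iff_sets dyadic_sets_def by (rule conjunct2)
  then have GS: "?G \<subseteq> sets (path_space {0..T})" by (rule UN_least)
  then show "sigma_sets ?\<Omega> ?G \<subseteq> sets (path_space {0..T})" by (rule sets.sigma_sets_subset)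
  \<comment> \<open>For the reverse inclusion it suffices that the identity is measurable from
    \<open>N\<close> into the product space.\<close>
  define N where "N = sigma ?\<Omega> ?G"
  have GP: "?G \<subseteq> Pow ?\<Omega>" using GS sets.space_closed by (rule order_trans)
  have N: "space N = ?\<Omega>" "sets N = sigma_sets ?\<Omega> ?G"
    unfolding N_def by (rule space_measure_of[OF GP], rule sets_measure_of[OF GP])
  have ev: "(\<lambda>x. x (real i * T / 2 ^ k)) \<in> borel_measurable N" if "i \<le> 2 ^ k" for i k
  proof -
    have vals: "dyadic_vals T k \<in> N \<rightarrow>\<^sub>M PiM {..2 ^ k} (\<lambda>_. borel)"
      unfolding measurable_iff_sets
    proof (rule conjI)
      show "dyadic_vals T k \<in> space N \<rightarrow> space (PiM {..2 ^ k} (\<lambda>_. borel))"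
        by (rule dyadic_vals_in)
      show "sets (vimage_algebra (space N) (dyadic_vals T k) (PiM {..2 ^ k} (\<lambda>_. borel))) \<subseteq> sets N"
        unfolding N(1) dyadic_sets_def[symmetric] unfolding N(2) using sigma_sets.Basic[of _ ?G ?\<Omega>] by blast
    qed
    have "i \<in> {..2 ^ k}" using that by simp
    then have "(\<lambda>x. dyadic_vals T k x i) \<in> borel_measurable N"
      by (rule measurable_compose[OF vals measurable_component_singleton])
    then show ?thesis using that by (simp add: dyadic_vals_def)
  qed
  \<comment> \<open>Evaluation at \<open>t\<close> is the pointwise limit, on continuous paths, of
    evaluations at the grid points to the left of \<open>t\<close>.\<close>
  have "(\<lambda>x. x t) \<in> borel_measurable N" if t: "t \<in> {0..T}" for t
  proof -
    let ?s = "\<lambda>k. real (nat \<lfloor>t * 2 ^ k / T\<rfloor>) * T / 2 ^ k"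
    have s: "(\<lambda>x. x (?s k)) \<in> borel_measurable N" for k
      by (rule ev[OF dyadic_floor(1)[OF T t]])
    have "(\<lambda>k. x (?s k)) \<longlonglongrightarrow> x t" if "x \<in> space N" for x
    proof -
      have "continuous_on {0..T} x" using that by (simp add: N space_path_space)
      moreover have "eventually (\<lambda>k. ?s k \<in> {0..T}) sequentially"
        using dyadic_time_in[OF less_imp_le[OF T] dyadic_floor(1)[OF T t]] by (intro always_eventually allI)
      ultimately show ?thesis
        by (rule continuous_on_tendsto_compose[where f=x, OF _ dyadic_floor(2)[OF T t] t])
    qed
    then show ?thesis
      by (rule borel_measurable_LIMSEQ_real[where u="\<lambda>k x. x (?s k)", OF _ s])
  qed
  then have "(\<lambda>x. \<lambda>t\<in>{0..T}. x t) \<in> N \<rightarrow>\<^sub>M PiM {0..T} (\<lambda>_. borel)"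
    by (rule measurable_restrict)
  moreover have "(\<lambda>t\<in>{0..T}. x t) = x" if "x \<in> space N" for x
    using that by (simp add: N space_path_space extensional_restrict)
  ultimately have id: "(\<lambda>x. x) \<in> N \<rightarrow>\<^sub>M PiM {0..T} (\<lambda>_. borel)"
    using measurable_cong[of N "\<lambda>x. \<lambda>t\<in>{0..T}. x t" "\<lambda>x. x" "PiM {0..T} (\<lambda>_. borel)"] by blast
  have "A \<in> sets N" if "A \<in> sets (path_space {0..T})" for A
  proof -
    have "A \<in> (\<inter>) {x. continuous_on {0..T} x} ` sets (PiM {0..T} (\<lambda>_. borel))"
      using that by (simp only: path_space_def sets_restrict_space)
    then obtain E where E: "E \<in> sets (PiM {0..T} (\<lambda>_. borel))" "A = {x. continuous_on {0..T} x} \<inter> E"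
      by (elim imageE)
    have "E \<subseteq> extensional {0..T}"
      using sets.sets_into_space[OF E(1)] by (simp add: space_PiM PiE_def)
    \<comment> \<open>\<open>E\<close> contains only extensional functions, so its continuous
      members are exactly its members in \<open>space N\<close>.\<close>
    then have A: "A = (\<lambda>x. x) -` E \<inter> space N"
      unfolding E(2) N(1) space_path_space by blast
    show ?thesis unfolding A by (rule measurable_sets[OF id E(1)])
  qed
  then show "sets (path_space {0..T}) \<subseteq> sigma_sets ?\<Omega> ?G"
    unfolding N(2) by (rule subsetI)
qed

section \<open>Brownian motion with drift\<close>

lemma continuous_on_primitive:
  fixes f :: "real \<Rightarrow> real"
  assumes f: "continuous_on UNIV f"
  shows "continuous_on {0..} (\<lambda>t. integral {0..t} f)"
  unfolding continuous_on_eq_continuous_within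
proof
  fix x :: real assume x: "x \<in> {0..}"
  have "f integrable_on {0..x + 1}"
    by (intro integrable_continuous_real continuous_on_subset[OF f]) simp
  then have "continuous_on {0..x + 1} (\<lambda>t. integral {0..t} f)"
    by (rule indefinite_integral_continuous_1)
  then have "continuous (at x within {0..x + 1}) (\<lambda>t. integral {0..t} f)"
    using x by (simp add: continuous_on_eq_continuous_within)
  \<comment> \<open>Continuity is local, and near \<open>x\<close> the half-line coincides with the
    compact interval.\<close>
  moreover have "at x within {0..x + 1} = at x within {0..}"
    by (rule at_within_nhd[of x "{..<x + 1}"]) auto
  ultimately show "continuous (at x within {0..}) (\<lambda>t. integral {0..t} f)" by simp
qed

text \<open>The increments of the primitives are the means of the Gaussian increments over a grid
  cell; this controls how far two drifts can move such a mean apart.\<close>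

lemma primitive_diff_bound:
  fixes f g :: "real \<Rightarrow> real"
  assumes f: "continuous_on UNIV f" and g: "continuous_on UNIV g"
    and B: "\<And>t. \<bar>f t - g t\<bar> \<le> B" and ab: "0 \<le> a" "a \<le> b"
  shows "\<bar>(integral {0..b} f - integral {0..a} f) - (integral {0..b} g - integral {0..a} g)\<bar> \<le> B * (b - a)"
proof -
  have int: "h integrable_on {c..d}" if "continuous_on UNIV h" for h :: "real \<Rightarrow> real" and c d
    by (intro integrable_continuous_real continuous_on_subset[OF that]) simp
  have "integral {0..b} h - integral {0..a} h = integral {a..b} h" if "continuous_on UNIV h" for h :: "real \<Rightarrow> real"
    using Henstock_Kurzweil_Integration.integral_combine[OF ab int[OF that]] by simp
  then have "(integral {0..b} f - integral {0..a} f) - (integral {0..b} g - integral {0..a} g)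
      = integral {a..b} (\<lambda>t. f t - g t)"
    using f g by (simp add: Henstock_Kurzweil_Integration.integral_diff int)
  also have "norm \<dots> \<le> B * (b - a)"
    using B ab by (intro integral_bound continuous_on_diff continuous_on_subset[OF f] continuous_on_subset[OF g]) auto
  finally show ?thesis by simp
qed

text \<open>Independent increments give a product law, and the deterministic shifts
  \<open>h i\<close> only move the means. The grid starts at time 0 and has constant mesh
  \<open>d\<close>, so all variances equal \<open>d\<close>.\<close>

lemma wiener_increments_distr:
  fixes h :: "nat \<Rightarrow> real"
  assumes W: "wiener_distribution Q" and d: "d > 0" and m: "m > 0"
  shows "distr Q (PiM {..<m} (\<lambda>_. borel))
      (\<lambda>x. \<lambda>i\<in>{..<m}. h i + (x (real (Suc i) * d) - x (real i * d)))
    = PiM {..<m} (\<lambda>i. density lborel (\<lambda>y. ennreal (normal_density (h i) (sqrt d) y)))"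
proof -
  interpret prob_space Q using W by (simp add: wiener_distribution_def)
  define X where "X i x = x (real (Suc i) * d) - x (real i * d)" for i and x :: "real \<Rightarrow> real"
  have mono: "strict_mono (\<lambda>i. real i * d)" using d by (simp add: strict_mono_def)
  have ind: "indep_vars (\<lambda>_. borel) X {..<m}"
  proof -
    have "\<forall>\<tau> m. 0 \<le> \<tau> 0 \<and> strict_mono \<tau> \<longrightarrow>
        indep_vars (\<lambda>_. borel) (\<lambda>i x. x (\<tau> (Suc i)) - x (\<tau> i)) {..<m}"
      using W by (simp add: wiener_distribution_def)
    from this[rule_format, of "\<lambda>i. real i * d" m] mono show ?thesis
      unfolding X_def[abs_def] by simp
  qed
  have "distributed Q lborel (X i) (normal_density 0 (sqrt d))" for i
  proof -
    have "distributed Q lborel (\<lambda>x. x (real (Suc i) * d) - x (real i * d))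
        (normal_density 0 (sqrt (real (Suc i) * d - real i * d)))"
    proof -
      have "\<forall>s t. 0 \<le> s \<and> s < t \<longrightarrow>
          distributed Q lborel (\<lambda>x. x t - x s) (normal_density 0 (sqrt (t - s)))"
        using W by (simp add: wiener_distribution_def)
      from this[rule_format, of "real i * d" "real (Suc i) * d"] d show ?thesis by simp
    qed
    moreover have "real (Suc i) * d - real i * d = d" by (simp add: algebra_simps)
    ultimately show ?thesis by (simp add: X_def[abs_def])
  qed
  from normal_density_affine[OF this, of 1 "h i" for i] d
  have dist: "distributed Q lborel (\<lambda>x. h i + X i x) (normal_density (h i) (sqrt d))" for i
    by simp
  have rv: "(\<lambda>x. h i + X i x) \<in> borel_measurable Q" for i
    using distributed_measurable[OF dist] by simp
  have "indep_vars (\<lambda>_. borel) (\<lambda>i x. h i + X i x) {..<m}"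
    by (rule indep_vars_compose2[OF ind]) simp
  then have "distr Q (PiM {..<m} (\<lambda>_. borel)) (\<lambda>x. \<lambda>i\<in>{..<m}. h i + X i x)
      = PiM {..<m} (\<lambda>i. distr Q borel (\<lambda>x. h i + X i x))"
    using m rv by (subst (asm) indep_vars_iff_distr_eq_PiM) auto
  moreover have "distr Q borel (\<lambda>x. h i + X i x)
      = density lborel (\<lambda>y. ennreal (normal_density (h i) (sqrt d) y))" for i
    using distributed_distr_eq_density[OF dist, of i] by (simp cong: distr_cong)
  ultimately show ?thesis by (simp add: X_def)
qed

text \<open>The law of the observation on \<open>{0..T}\<close> alone, which is all that an
  estimator sees of \<open>obs_law\<close>.\<close>

definition drift_law :: "real \<Rightarrow> (real \<Rightarrow> real) \<Rightarrow> (real \<Rightarrow> real) measure \<Rightarrow> (real \<Rightarrow> real) measure" where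
  "drift_law T f Q = distr Q (path_space {0..T}) (\<lambda>\<xi>. \<lambda>t\<in>{0..T}. integral {0..t} f + \<xi> t)"

lemma sets_drift_law [simp]: "sets (drift_law T f Q) = sets (path_space {0..T})"
  by (simp add: drift_law_def)

lemma drift_map_measurable:
  assumes W: "wiener_distribution Q" and f: "continuous_on UNIV f" and I: "I \<subseteq> {0..}"
  shows "(\<lambda>\<xi>. \<lambda>t\<in>I. integral {0..t} f + \<xi> t) \<in> Q \<rightarrow>\<^sub>M path_space I"
proof -
  have "sets Q = sets (path_space {0..})" using W by (simp add: wiener_distribution_def)
  from path_space_shift_measurable[OF I continuous_on_subset[OF continuous_on_primitive[OF f] I]]
  show ?thesis by (simp add: measurable_cong_sets[OF \<open>sets Q = _\<close> refl])
qed

lemma prob_space_drift_law: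
  assumes "wiener_distribution Q" "continuous_on UNIV f"
  shows "prob_space (drift_law T f Q)"
  unfolding drift_law_def
  using assms by (intro prob_space.prob_space_distr drift_map_measurable) (auto simp: wiener_distribution_def)

text \<open>Recovers the grid values of a path that starts at 0 from its increments.\<close>

definition partial_sums :: "nat \<Rightarrow> (nat \<Rightarrow> real) \<Rightarrow> nat \<Rightarrow> real" where
  "partial_sums m z = (\<lambda>i\<in>{..m}. \<Sum>l<i. z l)"

lemma partial_sums_measurable:
  "partial_sums m \<in> PiM {..<m} (\<lambda>_. borel) \<rightarrow>\<^sub>M PiM {..m} (\<lambda>_. borel)"
  unfolding partial_sums_def
  by (intro measurable_restrict borel_measurable_sum measurable_component_singleton) auto

text \<open>The grid values are partial sums of the increments, whose law is a product of normal
  laws. The probability of a cylinder set thus becomes an integral over that product.\<close>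

lemma emeasure_drift_law_dyadic:
  fixes f :: "real \<Rightarrow> real" and T :: real and k :: nat
  assumes W: "wiener_distribution Q" and f: "continuous_on UNIV f" and T: "T > 0"
    and E: "E \<in> sets (PiM {..2 ^ k} (\<lambda>_. borel))"
  defines "d \<equiv> T / 2 ^ k"
  shows "emeasure (drift_law T f Q) (dyadic_vals T k -` E \<inter> space (path_space {0..T}))
    = (\<integral>\<^sup>+z. indicator E (partial_sums (2 ^ k) z) \<partial>PiM {..<2 ^ k} (\<lambda>i. density lborel (\<lambda>y. ennreal
        (normal_density (integral {0..real (Suc i) * d} f - integral {0..real i * d} f) (sqrt d) y))))"
proof -
  define m where "m = (2::nat) ^ k"
  define H where "H t = integral {0..t} f" for t
  define Y where "Y \<xi> = (\<lambda>i\<in>{..<m}. (H (real (Suc i) * d) - H (real i * d))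
      + (\<xi> (real (Suc i) * d) - \<xi> (real i * d)))" for \<xi> :: "real \<Rightarrow> real"
  define D where "D \<xi> = (\<lambda>t\<in>{0..T}. H t + \<xi> t)" for \<xi> :: "real \<Rightarrow> real"
  have d: "d > 0" and m: "m > 0" using T by (simp_all add: d_def m_def)
  have sQ: "sets Q = sets (path_space {0..})" using W by (simp add: wiener_distribution_def)
  have [measurable]: "(\<lambda>\<xi>. \<xi> t) \<in> borel_measurable Q" if "t \<ge> 0" for t
    using path_space_eval[of t "{0..}"] that by (simp add: measurable_cong_sets[OF sQ refl])
  have Y: "Y \<in> Q \<rightarrow>\<^sub>M PiM {..<m} (\<lambda>_. borel)"
    unfolding Y_def using d by (intro measurable_restrict) measurable
  have D: "D \<in> Q \<rightarrow>\<^sub>M path_space {0..T}"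
    unfolding D_def H_def by (rule drift_map_measurable[OF W f]) auto
  have C: "dyadic_vals T k -` E \<inter> space (path_space {0..T}) \<in> sets (path_space {0..T})"
    by (rule measurable_sets[OF dyadic_vals_measurable[OF less_imp_le[OF T]] E])
  have F: "partial_sums m -` E \<inter> space (PiM {..<m} (\<lambda>_. borel)) \<in> sets (PiM {..<m} (\<lambda>_. borel))"
    using E by (intro measurable_sets[OF partial_sums_measurable]) (simp add: m_def)
  \<comment> \<open>The sum telescopes; the contribution of time 0 vanishes because the drift
    integral over a point is zero and the noise starts at zero.\<close>
  have eq: "dyadic_vals T k (D \<xi>) = partial_sums m (Y \<xi>)" if "\<xi> 0 = 0" for \<xi>
    unfolding dyadic_vals_def partial_sums_def m_def[symmetric]
  proof (rule restrict_ext)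
    fix i assume i: "i \<in> {..m}"
    have "(\<Sum>l<i. Y \<xi> l) = (\<Sum>l<i. (H (real (Suc l) * d) + \<xi> (real (Suc l) * d)) - (H (real l * d) + \<xi> (real l * d)))"
      using i by (intro sum.cong) (auto simp: Y_def)
    also have "\<dots> = H (real i * d) + \<xi> (real i * d) - (H (real 0 * d) + \<xi> (real 0 * d))"
      by (rule sum_lessThan_telescope)
    finally have "(\<Sum>l<i. Y \<xi> l) = H (real i * d) + \<xi> (real i * d)"
      using that by (simp add: H_def)
    moreover have "real i * d \<in> {0..T}"
      using dyadic_time_in[of T i k] i T by (simp add: d_def m_def)
    ultimately show "D \<xi> (real i * T / 2 ^ k) = (\<Sum>l<i. Y \<xi> l)"
      by (simp add: D_def d_def)
  qed
  have "emeasure (drift_law T f Q) (dyadic_vals T k -` E \<inter> space (path_space {0..T}))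
      = emeasure Q (D -` (dyadic_vals T k -` E \<inter> space (path_space {0..T})) \<inter> space Q)"
    unfolding drift_law_def H_def[symmetric] D_def[symmetric] by (rule emeasure_distr[OF D C])
  also have "\<dots> = emeasure Q (Y -` (partial_sums m -` E \<inter> space (PiM {..<m} (\<lambda>_. borel))) \<inter> space Q)"
  proof (rule emeasure_eq_AE)
    \<comment> \<open>Wiener paths start at 0 only almost surely, so the two events agree up to a
      null set.\<close>
    have "AE \<xi> in Q. \<xi> 0 = 0" using W by (simp add: wiener_distribution_def)
    then show "AE \<xi> in Q. \<xi> \<in> D -` (dyadic_vals T k -` E \<inter> space (path_space {0..T})) \<inter> space Q
        \<longleftrightarrow> \<xi> \<in> Y -` (partial_sums m -` E \<inter> space (PiM {..<m} (\<lambda>_. borel))) \<inter> space Q"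
    proof (rule AE_mp, intro AE_I2 impI)
      fix \<xi> assume "\<xi> \<in> space Q" "\<xi> 0 = 0"
      then show "\<xi> \<in> D -` (dyadic_vals T k -` E \<inter> space (path_space {0..T})) \<inter> space Q
        \<longleftrightarrow> \<xi> \<in> Y -` (partial_sums m -` E \<inter> space (PiM {..<m} (\<lambda>_. borel))) \<inter> space Q"
        using eq[of \<xi>] measurable_space[OF D, of \<xi>] measurable_space[OF Y, of \<xi>] by simp
    qed
  qed (use measurable_sets[OF D C] measurable_sets[OF Y F] in simp_all)
  also have "\<dots> = emeasure (distr Q (PiM {..<m} (\<lambda>_. borel)) Y)
      (partial_sums m -` E \<inter> space (PiM {..<m} (\<lambda>_. borel)))"
    by (rule emeasure_distr[OF Y F, symmetric])
  also have "\<dots> = (\<integral>\<^sup>+z. indicator (partial_sums m -` E \<inter> space (PiM {..<m} (\<lambda>_. borel))) z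
      \<partial>distr Q (PiM {..<m} (\<lambda>_. borel)) Y)"
    using F by simp
  also have "\<dots> = (\<integral>\<^sup>+z. indicator E (partial_sums m z) \<partial>distr Q (PiM {..<m} (\<lambda>_. borel)) Y)"
    by (intro nn_integral_cong) (auto simp: indicator_def)
  also have "distr Q (PiM {..<m} (\<lambda>_. borel)) Y
      = PiM {..<m} (\<lambda>i. density lborel (\<lambda>y. ennreal
        (normal_density (H (real (Suc i) * d) - H (real i * d)) (sqrt d) y)))"
    unfolding Y_def by (rule wiener_increments_distr[OF W d m])
  finally show ?thesis unfolding m_def H_def .
qed

text \<open>On a dyadic cylinder set the Gaussian inequality is applied to each of the
  \<open>2 ^ k\<close> increments. The resulting constant is the same on every level, which allows
  the passage from the algebra to all measurable sets.\<close>

lemma drift_law_measure_sq_le: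
  assumes W: "wiener_distribution Q" and T: "T > 0"
    and f: "continuous_on UNIV f" and g: "continuous_on UNIV g"
    and B: "\<And>t. \<bar>f t - g t\<bar> \<le> B"
    and A: "A \<in> sets (path_space {0..T})"
  shows "(measure (drift_law T f Q) A)\<^sup>2 \<le> exp (B\<^sup>2 * T) * measure (drift_law T g Q) A"
proof -
  let ?\<Omega> = "space (path_space {0..T})" and ?G = "\<Union>k. dyadic_sets T k"
  interpret Pf: prob_space "drift_law T f Q" by (rule prob_space_drift_law[OF W f])
  interpret Pg: prob_space "drift_law T g Q" by (rule prob_space_drift_law[OF W g])
  have cyl: "(measure (drift_law T f Q) C)\<^sup>2 \<le> exp (B\<^sup>2 * T) * measure (drift_law T g Q) C"
    if "C \<in> ?G" for C
  proof -
    from that obtain k where "C \<in> dyadic_sets T k" by blast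
    then obtain E where E: "E \<in> sets (PiM {..2 ^ k} (\<lambda>_. borel))"
      and C: "C = dyadic_vals T k -` E \<inter> ?\<Omega>"
      unfolding dyadic_sets_iff by (elim bexE)
    define d where "d = T / 2 ^ k"
    have d: "d > 0" using T by (simp add: d_def)
    define N where "N h i = density lborel (\<lambda>y. ennreal (normal_density
      (integral {0..real (Suc i) * d} h - integral {0..real i * d} h) (sqrt d) y))" for h i
    have ps: "prob_space (N h i)" for h i
      unfolding N_def using d by (intro prob_space_normal_density) simp
    define F where "F z = (indicator E (partial_sums (2 ^ k) z) :: ennreal)" for z
    have sN: "sets (PiM {..<2 ^ k} (N h)) = sets (PiM {..<2 ^ k} (\<lambda>_. borel))" for h
      by (rule sets_PiM_cong) (simp_all add: N_def)
    have "F \<in> borel_measurable (PiM {..<2 ^ k} (\<lambda>_. borel))"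
      unfolding F_def using measurable_compose[OF partial_sums_measurable borel_measurable_indicator[OF E]] .
    then have F: "F \<in> borel_measurable (PiM {..<2 ^ k} (N g))"
      by (simp add: measurable_cong_sets[OF sN refl])
    have e: "emeasure (drift_law T h Q) C = (\<integral>\<^sup>+z. F z \<partial>PiM {..<2 ^ k} (N h))"
      if "continuous_on UNIV h" for h
      unfolding C F_def N_def d_def by (rule emeasure_drift_law_dyadic[OF W that T E])
    have le: "(emeasure (drift_law T f Q) C)\<^sup>2
        \<le> (\<Prod>i<(2::nat) ^ k. ennreal (exp (B\<^sup>2 * d))) * (\<integral>\<^sup>+z. (F z)\<^sup>2 \<partial>PiM {..<2 ^ k} (N g))"
      unfolding e[OF f]
    proof (rule nn_integral_PiM_sq_le[where A="N f" and B="N g" and K="\<lambda>_. ennreal (exp (B\<^sup>2 * d))", OF _ ps ps _ _ F])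
      fix i and G :: "real \<Rightarrow> ennreal" assume G: "G \<in> borel_measurable (N g i)"
      \<comment> \<open>\<open>a\<close> and \<open>b\<close> are the means of the
        \<open>i\<close>-th increment under the two drifts. They differ by at most
        \<open>B * d\<close> and the variance is \<open>d\<close>, so one cell costs the factor
        \<open>exp (B\<^sup>2 * d)\<close>.\<close>
      define a where "a = integral {0..real (Suc i) * d} f - integral {0..real i * d} f"
      define b where "b = integral {0..real (Suc i) * d} g - integral {0..real i * d} g"
      have "\<bar>a - b\<bar> \<le> B * (real (Suc i) * d - real i * d)"
        unfolding a_def b_def using d by (intro primitive_diff_bound f g B) auto
      also have "\<dots> = B * d" by (simp add: algebra_simps)
      finally have "(a - b)\<^sup>2 \<le> (B * d)\<^sup>2" by (rule abs_le_square_iff[THEN iffD1, OF order_trans[OF _ abs_ge_self]])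
      then have le: "(a - b)\<^sup>2 / (sqrt d)\<^sup>2 \<le> B\<^sup>2 * d"
        using d by (simp add: pos_divide_le_eq power_mult_distrib power2_eq_square ac_simps)
      have "(\<integral>\<^sup>+x. G x \<partial>N f i)\<^sup>2 \<le> ennreal (exp ((a - b)\<^sup>2 / (sqrt d)\<^sup>2)) * (\<integral>\<^sup>+x. (G x)\<^sup>2 \<partial>N g i)"
        unfolding N_def a_def[symmetric] b_def[symmetric]
        using G d by (intro nn_integral_normal_sq_le) (simp_all add: N_def)
      also have "\<dots> \<le> ennreal (exp (B\<^sup>2 * d)) * (\<integral>\<^sup>+x. (G x)\<^sup>2 \<partial>N g i)"
        using le by (intro mult_right_mono ennreal_leI) auto
      finally show "(\<integral>\<^sup>+x. G x \<partial>N f i)\<^sup>2 \<le> ennreal (exp (B\<^sup>2 * d)) * (\<integral>\<^sup>+x. (G x)\<^sup>2 \<partial>N g i)" .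
    qed (simp_all add: N_def)
    \<comment> \<open>\<open>F\<close> is an indicator, so its second moment is again a
      probability.\<close>
    have F2: "(\<integral>\<^sup>+z. (F z)\<^sup>2 \<partial>PiM {..<2 ^ k} (N g)) = (\<integral>\<^sup>+z. F z \<partial>PiM {..<2 ^ k} (N g))"
      by (intro nn_integral_cong) (simp add: F_def indicator_def)
    \<comment> \<open>The cell lengths add up to \<open>T\<close>, and the level \<open>k\<close>
      disappears from the constant.\<close>
    have K: "(\<Prod>i<(2::nat) ^ k. ennreal (exp (B\<^sup>2 * d))) = ennreal (exp (B\<^sup>2 * T))"
      by (simp add: ennreal_power exp_of_nat_mult[symmetric] d_def)
    have "(emeasure (drift_law T f Q) C)\<^sup>2
        \<le> ennreal (exp (B\<^sup>2 * T)) * emeasure (drift_law T g Q) C"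
      using le unfolding K F2 e[OF g] .
    then show ?thesis
      by (simp add: Pf.emeasure_eq_measure Pg.emeasure_eq_measure ennreal_power ennreal_mult'[symmetric])
  qed
  show ?thesis
    by (rule measure_sq_le_sigma_sets[OF Pf.prob_space_axioms Pg.prob_space_axioms algebra_dyadic_sets
          _ _ cyl])
      (use A in \<open>simp_all only: sets_drift_law sets_path_space_dyadic[OF T] exp_ge_zero\<close>)
qed

section \<open>The trigonometric basis\<close>

text \<open>Integer frequencies are used because the product formulas produce differences
  \<open>p - q\<close>, which may be negative or zero.\<close>

lemma has_integral_cos_period:
  "((\<lambda>x. cos (2 * pi * real_of_int k * x)) has_integral (if k = 0 then 1 else 0)) {0..1}"
proof (cases "k = 0")
  case True
  then show ?thesis using has_integral_const_real[of "1::real" 0 1] by simp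
next
  case False
  let ?c = "2 * pi * real_of_int k"
  have "((\<lambda>x. cos (?c * x)) has_integral (sin (?c * 1) / ?c - sin (?c * 0) / ?c)) {0..1}"
    using False
    by (intro fundamental_theorem_of_calculus)
      (auto intro!: derivative_eq_intros simp: has_real_derivative_iff_has_vector_derivative[symmetric])
  moreover have "sin (?c * 1) = 0" using sin_int_2pin[of k] by simp
  ultimately show ?thesis using False by simp
qed

lemma has_integral_sin_period:
  "((\<lambda>x. sin (2 * pi * real_of_int k * x)) has_integral 0) {0..1}"
proof (cases "k = 0")
  case False
  let ?c = "2 * pi * real_of_int k"
  have "((\<lambda>x. sin (?c * x)) has_integral (- cos (?c * 1) / ?c - (- cos (?c * 0) / ?c))) {0..1}"
    using False
    by (intro fundamental_theorem_of_calculus)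
      (auto intro!: derivative_eq_intros simp: has_real_derivative_iff_has_vector_derivative[symmetric])
  moreover have "cos (?c * 1) = 1" using cos_int_2pin[of k] by simp
  ultimately show ?thesis by simp
qed simp

text \<open>Splits by parity into constant, cosine and sine, with the frequency cast through
  \<open>int\<close> to match the integrals over a period.\<close>

lemma trig_basis_cases:
  assumes "j \<ge> 1"
  obtains (one) "j = 1" "trig_basis j = (\<lambda>x. 1)"
  | (cos) p where "p \<ge> 1" "j = 2 * p" "trig_basis j = (\<lambda>x. sqrt 2 * cos (2 * pi * real_of_int (int p) * x))"
  | (sin) p where "p \<ge> 1" "j = 2 * p + 1" "trig_basis j = (\<lambda>x. sqrt 2 * sin (2 * pi * real_of_int (int p) * x))"
proof -
  consider "j = 1" | "j \<noteq> 1" "even j" | "j \<noteq> 1" "odd j" by blast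
  then show thesis
  proof cases
    case 1 then show thesis by (intro one) (auto simp: trig_basis_def)
  next
    case 2 then show thesis using assms
      by (intro cos[of "j div 2"]) (auto simp: trig_basis_def Tr_def fun_eq_iff elim!: evenE)
  next
    case 3 then show thesis using assms
      by (intro sin[of "j div 2"]) (auto simp: trig_basis_def Tr_def fun_eq_iff elim!: oddE)
  qed
qed

text \<open>Product-to-sum formulas. The term for \<open>p + q = 0\<close> doubles the cosine
  integral and cancels the sine integral at zero frequency; for positive frequencies it
  vanishes.\<close>

lemma has_integral_trig_products:
  fixes p q :: int
  shows "((\<lambda>x. (sqrt 2 * cos (2 * pi * real_of_int p * x)) * (sqrt 2 * cos (2 * pi * real_of_int q * x)))
      has_integral (if p = q then 1 else 0) + (if p + q = 0 then 1 else 0)) {0..1}" (is ?cc)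
    and "((\<lambda>x. (sqrt 2 * sin (2 * pi * real_of_int p * x)) * (sqrt 2 * sin (2 * pi * real_of_int q * x)))
      has_integral (if p = q then 1 else 0) - (if p + q = 0 then 1 else 0)) {0..1}" (is ?ss)
    and "((\<lambda>x. (sqrt 2 * sin (2 * pi * real_of_int p * x)) * (sqrt 2 * cos (2 * pi * real_of_int q * x)))
      has_integral 0) {0..1}" (is ?sc)
proof -
  let ?a = "\<lambda>k x. 2 * pi * real_of_int k * x"
  have add: "?a (p + q) x = ?a p x + ?a q x" and diff: "?a (p - q) x = ?a p x - ?a q x" for x
    by (simp_all add: algebra_simps)
  have s2: "(sqrt 2 * u) * (sqrt 2 * v) = 2 * (u * v)" for u v :: real
    by (simp add: algebra_simps)
  have "(sqrt 2 * cos (?a p x)) * (sqrt 2 * cos (?a q x)) = cos (?a (p - q) x) + cos (?a (p + q) x)" for x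
    unfolding add diff s2 by (simp add: cos_add cos_diff)
  then show ?cc
    using has_integral_add[OF has_integral_cos_period[of "p - q"] has_integral_cos_period[of "p + q"]]
    by simp
  have "(sqrt 2 * sin (?a p x)) * (sqrt 2 * sin (?a q x)) = cos (?a (p - q) x) - cos (?a (p + q) x)" for x
    unfolding add diff s2 by (simp add: cos_add cos_diff)
  then show ?ss
    using has_integral_diff[OF has_integral_cos_period[of "p - q"] has_integral_cos_period[of "p + q"]]
    by simp
  have "(sqrt 2 * sin (?a p x)) * (sqrt 2 * cos (?a q x)) = sin (?a (p - q) x) + sin (?a (p + q) x)" for x
    unfolding add diff s2 by (simp add: sin_add sin_diff)
  then show ?sc
    using has_integral_add[OF has_integral_sin_period[of "p - q"] has_integral_sin_period[of "p + q"]]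
    by simp
qed

lemma trig_basis_orthonormal:
  assumes i1: "i \<ge> 1" and j1: "j \<ge> 1"
  shows "((\<lambda>x. trig_basis i x * trig_basis j x) has_integral (if i = j then 1 else 0)) {0..1}"
proof -
  have c: "((\<lambda>x. sqrt 2 * cos (2 * pi * real_of_int (int p) * x)) has_integral 0) {0..1}" if "p \<ge> 1" for p :: nat
    using has_integral_mult_right[OF has_integral_cos_period[of "int p"], of "sqrt 2"] that by simp
  have s: "((\<lambda>x. sqrt 2 * sin (2 * pi * real_of_int (int p) * x)) has_integral 0) {0..1}" for p :: nat
    using has_integral_mult_right[OF has_integral_sin_period[of "int p"], of "sqrt 2"] by simp
  note prods = has_integral_trig_products[of "int p" "int q" for p q]
  from i1 show ?thesis
  proof (cases rule: trig_basis_cases)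
    case i: one
    from j1 show ?thesis
    proof (cases rule: trig_basis_cases)
      case one
      then show ?thesis using i has_integral_const_real[of "1::real" 0 1] by simp
    next
      case (cos p)
      have "i \<noteq> j" using i(1) cos(1,2) by simp
      then show ?thesis unfolding i(2) cos(3) using c[OF cos(1)] by simp
    next
      case (sin p)
      have "i \<noteq> j" using i(1) sin(1,2) by simp
      then show ?thesis unfolding i(2) sin(3) using s[of p] by simp
    qed
  next
    case i: (cos p)
    from j1 show ?thesis
    proof (cases rule: trig_basis_cases)
      case one
      have "i \<noteq> j" using i(1,2) one(1) by simp
      then show ?thesis unfolding i(3) one(2) using c[OF i(1)] by simp
    next
      case (cos q)
      have "(if int p = int q then 1 else 0) + (if int p + int q = 0 then 1 else 0)
          = (if i = j then 1 else (0::real))"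
        using i(1,2) cos(1,2) by simp
      then show ?thesis unfolding i(3) cos(3) using prods(1)[of p q] by (simp only:)
    next
      case (sin q)
      have "i \<noteq> j" using i(2) sin(2) by presburger
      then show ?thesis unfolding i(3) sin(3)
        using prods(3)[of q p] by (simp only: mult.commute[of "sqrt 2 * cos _"] if_False)
    qed
  next
    case i: (sin p)
    from j1 show ?thesis
    proof (cases rule: trig_basis_cases)
      case one
      have "i \<noteq> j" using i(1,2) one(1) by simp
      then show ?thesis unfolding i(3) one(2) using s[of p] by simp
    next
      case (cos q)
      have "i \<noteq> j" using i(2) cos(2) by presburger
      then show ?thesis unfolding i(3) cos(3) using prods(3)[of p q] by (simp only: if_False)
    next
      case (sin q)
      have "(if int p = int q then 1 else 0) - (if int p + int q = 0 then 1 else 0)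
          = (if i = j then 1 else (0::real))"
        using i(1,2) sin(1,2) by simp
      then show ?thesis unfolding i(3) sin(3) using prods(2)[of p q] by (simp only:)
    qed
  qed
qed

lemma continuous_on_trig_basis [continuous_intros]: "continuous_on A (trig_basis j)"
  unfolding trig_basis_def[abs_def] Tr_def
  by (cases "j = 1"; cases "even j") (auto intro!: continuous_intros)

lemma trig_basis_periodic: "trig_basis j (t + 1) = trig_basis j t"
proof -
  have "2 * pi * real (j div 2) * (t + 1) = 2 * pi * real (j div 2) * t + 2 * pi * real (j div 2)"
    by (simp add: algebra_simps)
  moreover have "cos (2 * pi * real (j div 2)) = 1" "sin (2 * pi * real (j div 2)) = 0"
    using cos_int_2pin[of "int (j div 2)"] sin_int_2pin[of "int (j div 2)"] by simp_all
  ultimately show ?thesis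
    by (simp add: trig_basis_def Tr_def sin_add cos_add)
qed

lemma abs_trig_basis_le: "\<bar>trig_basis j t\<bar> \<le> sqrt 2"
proof -
  have "sqrt 2 * \<bar>u\<bar> \<le> sqrt 2" if "\<bar>u\<bar> \<le> 1" for u :: real
    using mult_left_mono[OF that, of "sqrt 2"] by simp
  then show ?thesis
    by (simp add: trig_basis_def Tr_def abs_mult abs_cos_le_one abs_sin_le_one)
qed

section \<open>Fourier coefficients, Bessel's inequality and measurability of coordinates\<close>

lemma borel_measurable_trig_basis [measurable]: "trig_basis j \<in> borel_measurable (lebesgue_on {0..1})"
  by (rule continuous_imp_measurable_on_sets_lebesgue[OF continuous_on_trig_basis]) simp

lemma X_inner_trig_basis:
  assumes "i \<ge> 1" "j \<ge> 1"
  shows "X_inner (trig_basis i) (trig_basis j) = (if i = j then 1 else 0)"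
proof -
  have "integrable (lebesgue_on {0..1}) (\<lambda>t. trig_basis i t * trig_basis j t)"
    by (intro continuous_imp_integrable_real continuous_intros)
  then have "X_inner (trig_basis i) (trig_basis j) = integral {0..1} (\<lambda>t. trig_basis i t * trig_basis j t)"
    unfolding X_inner_def by (rule lebesgue_integral_eq_integral) simp
  also have "\<dots> = (if i = j then 1 else 0)"
    by (rule integral_unique[OF trig_basis_orthonormal[OF assms]])
  finally show ?thesis .
qed

text \<open>Since \<open>2 * \<bar>u * v\<bar> \<le> u\<^sup>2 + v\<^sup>2\<close> and the basis
  functions are bounded by \<open>sqrt 2\<close>, the product is dominated by the integrable
  function \<open>(h t)\<^sup>2 + 2\<close>.\<close>

lemma integrable_mult_trig_basis:
  assumes "h \<in> X_space"
  shows "integrable (lebesgue_on {0..1}) (\<lambda>t. h t * trig_basis j t)"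
proof (rule Bochner_Integration.integrable_bound)
  have h: "h \<in> borel_measurable (lebesgue_on {0..1})" "integrable (lebesgue_on {0..1}) (\<lambda>t. (h t)\<^sup>2)"
    using assms by (auto simp: X_space_def sq_integrable_def)
  have "integrable (lebesgue_on {0..1}) (\<lambda>t::real. 2 :: real)"
    by (rule continuous_imp_integrable_real) simp
  with h(2) show "integrable (lebesgue_on {0..1}) (\<lambda>t. (h t)\<^sup>2 + 2)" by simp
  show "(\<lambda>t. h t * trig_basis j t) \<in> borel_measurable (lebesgue_on {0..1})"
    using h(1) by simp
  show "AE t in lebesgue_on {0..1}. norm (h t * trig_basis j t) \<le> norm ((h t)\<^sup>2 + 2)"
  proof (intro AE_I2)
    fix t
    have "(trig_basis j t)\<^sup>2 \<le> (sqrt 2)\<^sup>2"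
      using abs_trig_basis_le[of j t] by (intro abs_le_square_iff[THEN iffD1]) simp
    moreover have "2 * \<bar>h t * trig_basis j t\<bar> \<le> (h t)\<^sup>2 + (trig_basis j t)\<^sup>2"
      using sum_squares_bound[of "\<bar>h t\<bar>" "\<bar>trig_basis j t\<bar>"] by (simp add: abs_mult mult.assoc)
    moreover have "(h t)\<^sup>2 \<ge> 0" by simp
    ultimately have "\<bar>h t * trig_basis j t\<bar> \<le> (h t)\<^sup>2 + 2" by (simp del: zero_le_power2)
    then show "norm (h t * trig_basis j t) \<le> norm ((h t)\<^sup>2 + 2)" by simp
  qed
qed

lemma X_space_diff:
  assumes "f \<in> X_space" "g \<in> X_space"
  shows "(\<lambda>t. f t - g t) \<in> X_space"
proof -
  have f: "f \<in> borel_measurable (lebesgue_on {0..1})" "integrable (lebesgue_on {0..1}) (\<lambda>t. (f t)\<^sup>2)"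
    and g: "g \<in> borel_measurable (lebesgue_on {0..1})" "integrable (lebesgue_on {0..1}) (\<lambda>t. (g t)\<^sup>2)"
    using assms by (auto simp: X_space_def sq_integrable_def)
  have "integrable (lebesgue_on {0..1}) (\<lambda>t. (f t - g t)\<^sup>2)"
  proof (rule Bochner_Integration.integrable_bound)
    show "integrable (lebesgue_on {0..1}) (\<lambda>t. 2 * (f t)\<^sup>2 + 2 * (g t)\<^sup>2)"
      using f(2) g(2) by simp
    show "(\<lambda>t. (f t - g t)\<^sup>2) \<in> borel_measurable (lebesgue_on {0..1})"
      using f(1) g(1) by simp
    have "(u - v)\<^sup>2 \<le> 2 * u\<^sup>2 + 2 * v\<^sup>2" for u v :: real
      using zero_le_power2[of "u + v"] by (simp add: power2_eq_square algebra_simps)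
    then show "AE t in lebesgue_on {0..1}. norm ((f t - g t)\<^sup>2) \<le> norm (2 * (f t)\<^sup>2 + 2 * (g t)\<^sup>2)"
      by (intro AE_I2) simp
  qed
  then show ?thesis using assms f(1) g(1) by (simp add: X_space_def sq_integrable_def)
qed

lemma X_inner_diff_trig_basis:
  assumes "f \<in> X_space" "g \<in> X_space"
  shows "X_inner (\<lambda>t. f t - g t) (trig_basis j) = X_inner f (trig_basis j) - X_inner g (trig_basis j)"
  using integrable_mult_trig_basis[OF assms(1)] integrable_mult_trig_basis[OF assms(2)]
  by (simp add: X_inner_def left_diff_distrib)

lemma X_norm_square: "(X_norm h)\<^sup>2 = X_inner h h"
  unfolding X_norm_def by (intro real_sqrt_pow2) (simp add: X_inner_def)

text \<open>Expand the nonnegative integral of the squared residual of \<open>h\<close> after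
  subtracting its finite Fourier sum; orthonormality collapses the double sum.\<close>

lemma bessel_trig_basis:
  assumes h: "h \<in> X_space" and I: "finite I" "I \<subseteq> {1..}"
  shows "(\<Sum>j\<in>I. (X_inner h (trig_basis j))\<^sup>2) \<le> (X_norm h)\<^sup>2"
proof -
  let ?M = "lebesgue_on {0..1::real}"
  define a where "a j = X_inner h (trig_basis j)" for j
  have h2: "integrable ?M (\<lambda>t. h t * h t)"
    using h by (simp add: X_space_def sq_integrable_def power2_eq_square)
  have ii: "integrable ?M (\<lambda>t. trig_basis j t * trig_basis i t)" for i j
    by (intro continuous_imp_integrable_real continuous_intros)
  have "0 \<le> (LINT t|?M. (h t - (\<Sum>j\<in>I. a j * trig_basis j t))\<^sup>2)" by simp
  also have "(\<lambda>t. (h t - (\<Sum>j\<in>I. a j * trig_basis j t))\<^sup>2) = (\<lambda>t. h t * h t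
      - 2 * (\<Sum>j\<in>I. a j * (h t * trig_basis j t))
      + (\<Sum>j\<in>I. \<Sum>i\<in>I. (a j * a i) * (trig_basis j t * trig_basis i t)))"
    by (rule ext) (simp add: power2_eq_square algebra_simps sum_distrib_left sum_distrib_right sum_product)
  also have "(LINT t|?M. h t * h t
      - 2 * (\<Sum>j\<in>I. a j * (h t * trig_basis j t))
      + (\<Sum>j\<in>I. \<Sum>i\<in>I. (a j * a i) * (trig_basis j t * trig_basis i t)))
    = X_inner h h - 2 * (\<Sum>j\<in>I. a j * X_inner h (trig_basis j))
      + (\<Sum>j\<in>I. \<Sum>i\<in>I. (a j * a i) * X_inner (trig_basis j) (trig_basis i))"
    using h2 ii integrable_mult_trig_basis[OF h] by (simp add: X_inner_def)
  also have "(\<Sum>j\<in>I. \<Sum>i\<in>I. (a j * a i) * X_inner (trig_basis j) (trig_basis i)) = (\<Sum>j\<in>I. (a j)\<^sup>2)"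
  proof (rule sum.cong[OF refl])
    fix j assume j: "j \<in> I"
    have "(\<Sum>i\<in>I. (a j * a i) * X_inner (trig_basis j) (trig_basis i)) = (\<Sum>i\<in>I. if j = i then (a j)\<^sup>2 else 0)"
      using I j by (intro sum.cong) (auto simp: X_inner_trig_basis subset_eq power2_eq_square)
    then show "(\<Sum>i\<in>I. (a j * a i) * X_inner (trig_basis j) (trig_basis i)) = (a j)\<^sup>2"
      using I j by simp
  qed
  also have "(\<Sum>j\<in>I. a j * X_inner h (trig_basis j)) = (\<Sum>j\<in>I. (a j)\<^sup>2)"
    by (simp add: a_def power2_eq_square)
  finally show ?thesis unfolding X_norm_square a_def by linarith
qed

text \<open>By Bessel's inequality with a single index the coordinate is 1-Lipschitz for
  \<open>X_norm\<close>, so the preimage of an open set is one of the generators of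
  \<open>X_borel\<close>.\<close>

lemma X_inner_trig_basis_measurable:
  assumes j: "j \<ge> 1"
  shows "(\<lambda>g. X_inner g (trig_basis j)) \<in> borel_measurable X_borel"
proof (rule borel_measurableI)
  let ?O = "{U. U \<subseteq> X_space \<and>
         (\<forall>f\<in>U. \<exists>\<epsilon>>0. \<forall>g\<in>X_space. X_norm (\<lambda>t. g t - f t) < \<epsilon> \<longrightarrow> g \<in> U)}"
  have O: "?O \<subseteq> Pow X_space" by blast
  have sp: "space X_borel = X_space" and se: "sets X_borel = sigma_sets X_space ?O"
    unfolding X_borel_def by (rule space_measure_of[OF O], rule sets_measure_of[OF O])
  fix S :: "real set" assume S: "open S"
  let ?U = "(\<lambda>g. X_inner g (trig_basis j)) -` S \<inter> X_space"
  have "\<exists>\<epsilon>>0. \<forall>g\<in>X_space. X_norm (\<lambda>t. g t - f t) < \<epsilon> \<longrightarrow> g \<in> ?U" if f: "f \<in> ?U" for f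
  proof -
    obtain \<epsilon> where \<epsilon>: "\<epsilon> > 0" "\<And>y. dist y (X_inner f (trig_basis j)) < \<epsilon> \<Longrightarrow> y \<in> S"
      using S f unfolding open_dist by blast
    have "g \<in> ?U" if g: "g \<in> X_space" and n: "X_norm (\<lambda>t. g t - f t) < \<epsilon>" for g
    proof -
      have fX: "f \<in> X_space" using f by blast
      have "(X_inner (\<lambda>t. g t - f t) (trig_basis j))\<^sup>2 \<le> (X_norm (\<lambda>t. g t - f t))\<^sup>2"
        using bessel_trig_basis[OF X_space_diff[OF g fX], of "{j}"] j by simp
      moreover have "X_norm (\<lambda>t. g t - f t) \<ge> 0"
        unfolding X_norm_def by (simp add: X_inner_def)
      ultimately have "\<bar>X_inner (\<lambda>t. g t - f t) (trig_basis j)\<bar> \<le> X_norm (\<lambda>t. g t - f t)"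
        by (simp add: abs_le_square_iff[symmetric])
      then have "dist (X_inner g (trig_basis j)) (X_inner f (trig_basis j)) < \<epsilon>"
        using n by (simp add: X_inner_diff_trig_basis[OF g fX] dist_real_def)
      then show ?thesis using \<epsilon>(2) g by blast
    qed
    then show ?thesis using \<epsilon>(1) by blast
  qed
  then have "?U \<in> ?O" by blast
  then show "(\<lambda>g. X_inner g (trig_basis j)) -` S \<inter> space X_borel \<in> sets X_borel"
    unfolding sp se by (rule sigma_sets.Basic)
qed

section \<open>The cube of signals\<close>

definition trig_sum :: "real \<Rightarrow> nat set \<Rightarrow> real \<Rightarrow> real" where
  "trig_sum \<delta> J t = (\<Sum>j\<in>J. \<delta> * trig_basis j t)"

lemma continuous_on_trig_sum: "continuous_on A (trig_sum \<delta> J)"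
  unfolding trig_sum_def[abs_def] by (intro continuous_intros)

lemma trig_sum_in_X_space: "trig_sum \<delta> J \<in> X_space"
proof -
  have "integrable (lebesgue_on {0..1}) (\<lambda>t. (trig_sum \<delta> J t)\<^sup>2)"
    by (intro continuous_imp_integrable_real continuous_intros continuous_on_trig_sum)
  moreover have "trig_sum \<delta> J \<in> borel_measurable (lebesgue_on {0..1})"
    by (rule continuous_imp_measurable_on_sets_lebesgue[OF continuous_on_trig_sum]) simp
  ultimately show ?thesis
    by (simp add: X_space_def sq_integrable_def trig_sum_def trig_basis_periodic)
qed

lemma X_inner_trig_sum:
  assumes J: "finite J" "J \<subseteq> {1..}" and i: "i \<ge> 1"
  shows "X_inner (trig_sum \<delta> J) (trig_basis i) = (if i \<in> J then \<delta> else 0)"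
proof -
  have ii: "integrable (lebesgue_on {0..1}) (\<lambda>t. trig_basis j t * trig_basis i t)" for j
    by (intro continuous_imp_integrable_real continuous_intros)
  have "X_inner (trig_sum \<delta> J) (trig_basis i) = (\<Sum>j\<in>J. \<delta> * X_inner (trig_basis j) (trig_basis i))"
    using ii by (simp add: X_inner_def trig_sum_def sum_distrib_right mult.assoc)
  also have "\<dots> = (\<Sum>j\<in>J. if i = j then \<delta> else 0)"
    using J i by (intro sum.cong) (auto simp: X_inner_trig_basis subset_eq)
  also have "\<dots> = (if i \<in> J then \<delta> else 0)" using J(1) by simp
  finally show ?thesis .
qed

text \<open>For \<open>1 \<le> n \<le> m\<close> at most \<open>m\<close> coefficients remain in the
  tail, each at most \<open>\<delta>\<^sup>2\<close> when squared, and the weight is at most that of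
  \<open>m\<close>; for \<open>n > m\<close> the tail is zero.\<close>

lemma trig_sum_in_Theta:
  assumes J: "J \<subseteq> {1..m}" and m: "real m powr (2 * \<beta> + 1) * \<delta>\<^sup>2 \<le> r\<^sup>2" and \<beta>: "\<beta> \<ge> 0"
  shows "trig_sum \<delta> J \<in> Theta \<beta> r"
proof -
  have fJ: "finite J" "J \<subseteq> {1..}" using J finite_subset by auto
  have tail: "ennreal (real n powr (2 * \<beta>)) * fourier_tail n (trig_sum \<delta> J) \<le> ennreal (r\<^sup>2)"
    if n: "n \<in> {1..}" for n
  proof -
    have co: "(X_inner (trig_sum \<delta> J) (trig_basis (n + i)))\<^sup>2 = (if n + i \<in> J then \<delta>\<^sup>2 else 0)" for i
      using X_inner_trig_sum[OF fJ, of "n + i" \<delta>] n by simp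
    have ft: "fourier_tail n (trig_sum \<delta> J) = (\<Sum>i. ennreal (if n + i \<in> J then \<delta>\<^sup>2 else 0))"
      unfolding fourier_tail_def co ..
    \<comment> \<open>Nonzero terms need \<open>n + i \<le> m\<close>; the truncated subtraction
      leaves an empty range when \<open>n > m\<close>.\<close>
    have out: "n + i \<notin> J" if "i \<notin> {..<Suc m - n}" for i
    proof
      assume "n + i \<in> J"
      then have "n + i \<le> m" using J by auto
      then show False using that by simp
    qed
    have "(\<Sum>i. ennreal (if n + i \<in> J then \<delta>\<^sup>2 else 0))
        = (\<Sum>i\<in>{..<Suc m - n}. ennreal (if n + i \<in> J then \<delta>\<^sup>2 else 0))"
      using out by (intro suminf_finite) auto
    also have "\<dots> \<le> (\<Sum>i\<in>{..<Suc m - n}. ennreal (\<delta>\<^sup>2))"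
      by (intro sum_mono) simp
    also have "\<dots> = ennreal (real (Suc m - n) * \<delta>\<^sup>2)"
      by (simp add: ennreal_mult' ennreal_of_nat_eq_real_of_nat)
    finally have ft_le: "fourier_tail n (trig_sum \<delta> J) \<le> ennreal (real (Suc m - n) * \<delta>\<^sup>2)"
      unfolding ft .
    show ?thesis
    proof (cases "n \<le> m")
      case True
      have "ennreal (real n powr (2 * \<beta>)) * fourier_tail n (trig_sum \<delta> J)
          \<le> ennreal (real n powr (2 * \<beta>)) * ennreal (real (Suc m - n) * \<delta>\<^sup>2)"
        by (rule mult_left_mono[OF ft_le]) simp
      also have "\<dots> = ennreal (real n powr (2 * \<beta>) * (real (Suc m - n) * \<delta>\<^sup>2))"
        by (rule ennreal_mult'[symmetric]) simp
      also have "\<dots> \<le> ennreal (r\<^sup>2)"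
      proof (rule ennreal_leI)
        have "real n powr (2 * \<beta>) \<le> real m powr (2 * \<beta>)"
          using True \<beta> by (intro powr_mono2) auto
        moreover have "real (Suc m - n) \<le> real m" using n by simp
        ultimately have "real n powr (2 * \<beta>) * (real (Suc m - n) * \<delta>\<^sup>2)
            \<le> real m powr (2 * \<beta>) * (real m * \<delta>\<^sup>2)"
          by (intro mult_mono mult_right_mono) auto
        also have "\<dots> = real m powr (2 * \<beta> + 1) * \<delta>\<^sup>2" by (simp add: powr_add)
        also note m
        finally show "real n powr (2 * \<beta>) * (real (Suc m - n) * \<delta>\<^sup>2) \<le> r\<^sup>2" .
      qed
      finally show ?thesis .
    next
      case False
      then have "Suc m - n = 0" by simp
      then have "fourier_tail n (trig_sum \<delta> J) = 0" using ft_le by simp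
      then show ?thesis by simp
    qed
  qed
  then show ?thesis
    unfolding Theta_def using trig_sum_in_X_space continuous_on_trig_sum by (auto intro!: SUP_least)
qed

section \<open>Lower bounds for the risk\<close>

text \<open>An estimate \<open>u\<close> yields the test \<open>u > \<delta> / 2\<close>. On either
  wrong decision the squared error is at least \<open>\<delta>\<^sup>2 / 4\<close>, and
  \<open>le\<close> prevents both error probabilities from being small.\<close>

lemma two_point_bound:
  fixes u :: "'a \<Rightarrow> real"
  assumes M: "prob_space M" and N: "prob_space N" and s: "sets N = sets M"
    and u: "u \<in> borel_measurable M" and \<delta>: "\<delta> > 0" and K: "K \<ge> 1"
    and le: "\<And>A. A \<in> sets M \<Longrightarrow> (measure N A)\<^sup>2 \<le> K * measure M A"
  shows "ennreal (\<delta>\<^sup>2 / (16 * K))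
    \<le> (\<integral>\<^sup>+x. ennreal ((u x)\<^sup>2) \<partial>M) + (\<integral>\<^sup>+x. ennreal ((u x - \<delta>)\<^sup>2) \<partial>N)"
proof -
  interpret M: prob_space M by fact
  interpret N: prob_space N by fact
  define A where "A = {x \<in> space M. u x > \<delta> / 2}"
  have A: "A \<in> sets M" unfolding A_def using u by measurable
  have sp: "space N = space M" by (rule sets_eq_imp_space_eq[OF s])
  define p where "p = measure N A"
  have p: "0 \<le> p" "p \<le> 1" by (simp_all add: p_def)
  \<comment> \<open>If \<open>p \<le> 1 / 2\<close>, the test misses \<open>N\<close> with
    probability at least one half; otherwise \<open>p\<^sup>2 / K\<close>, a lower bound for the
    false alarm under \<open>M\<close>, exceeds \<open>1 / (4 * K)\<close>.\<close>
  have "1 / (4 * K) \<le> p\<^sup>2 / K + (1 - p)"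
  proof (cases "p \<le> 1 / 2")
    case True
    have "1 / (4 * K) \<le> 1 / 2" using K by (simp add: field_simps)
    moreover have "0 \<le> p\<^sup>2 / K" using K by simp
    ultimately show ?thesis using True by linarith
  next
    case False
    then have "(1 / 2)\<^sup>2 \<le> p\<^sup>2" by (intro power_mono) auto
    then have "(1 / 4) / K \<le> p\<^sup>2 / K" using K by (intro divide_right_mono) (auto simp: power2_eq_square)
    then show ?thesis using p(2) by (simp add: field_simps)
  qed
  also have "p\<^sup>2 / K \<le> measure M A"
    using le[OF A] K by (simp add: p_def pos_divide_le_eq mult.commute)
  finally have "\<delta>\<^sup>2 / 4 * (1 / (4 * K)) \<le> \<delta>\<^sup>2 / 4 * (measure M A + (1 - p))"
    by (intro mult_left_mono) auto
  then have "\<delta>\<^sup>2 / (16 * K) \<le> \<delta>\<^sup>2 / 4 * measure M A + \<delta>\<^sup>2 / 4 * (1 - p)"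
    by (simp add: field_simps)
  then have "ennreal (\<delta>\<^sup>2 / (16 * K)) \<le> ennreal (\<delta>\<^sup>2 / 4 * measure M A + \<delta>\<^sup>2 / 4 * (1 - p))"
    by (rule ennreal_leI)
  also have "\<dots> = ennreal (\<delta>\<^sup>2 / 4) * emeasure M A + ennreal (\<delta>\<^sup>2 / 4) * emeasure N (space M - A)"
  proof -
    have "measure N (space M - A) = 1 - p"
      using N.prob_compl[of A] A s by (simp add: p_def sp)
    then show ?thesis
      using p by (simp add: M.emeasure_eq_measure N.emeasure_eq_measure ennreal_mult'[symmetric])
  qed
  also have "ennreal (\<delta>\<^sup>2 / 4) * emeasure M A = (\<integral>\<^sup>+x. ennreal (\<delta>\<^sup>2 / 4) * indicator A x \<partial>M)"
    using A by (simp add: nn_integral_cmult_indicator)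
  also have "\<dots> \<le> (\<integral>\<^sup>+x. ennreal ((u x)\<^sup>2) \<partial>M)"
  proof (rule nn_integral_mono)
    fix x
    have "\<delta>\<^sup>2 / 4 \<le> (u x)\<^sup>2" if "x \<in> A"
      using that \<delta> power_mono[of "\<delta> / 2" "u x" 2] by (simp add: A_def power_divide)
    then show "ennreal (\<delta>\<^sup>2 / 4) * indicator A x \<le> ennreal ((u x)\<^sup>2)"
      by (auto simp: indicator_def intro: ennreal_leI)
  qed
  also have "ennreal (\<delta>\<^sup>2 / 4) * emeasure N (space M - A)
      = (\<integral>\<^sup>+x. ennreal (\<delta>\<^sup>2 / 4) * indicator (space M - A) x \<partial>N)"
    using A s by (simp add: nn_integral_cmult_indicator)
  also have "\<dots> \<le> (\<integral>\<^sup>+x. ennreal ((u x - \<delta>)\<^sup>2) \<partial>N)"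
  proof (rule nn_integral_mono)
    fix x
    have "\<delta>\<^sup>2 / 4 \<le> (u x - \<delta>)\<^sup>2" if "x \<in> space M - A"
    proof -
      have "\<delta> / 2 \<le> \<delta> - u x" using that by (auto simp: A_def)
      then show ?thesis
        using \<delta> power_mono[of "\<delta> / 2" "\<delta> - u x" 2] by (simp add: power_divide power2_commute[of "u x"])
    qed
    then show "ennreal (\<delta>\<^sup>2 / 4) * indicator (space M - A) x \<le> ennreal ((u x - \<delta>)\<^sup>2)"
      by (auto simp: indicator_def intro: ennreal_leI)
  qed
  finally show ?thesis by (simp add: add_mono)
qed

text \<open>Average over all vertices \<open>J\<close> of the cube. \<open>e J j\<close> stands for
  the error in coordinate \<open>j\<close> at vertex \<open>J\<close>, and the mean of the total
  error over the vertices cannot exceed \<open>R\<close>.\<close>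

lemma assouad:
  fixes e :: "'i set \<Rightarrow> 'i \<Rightarrow> ennreal"
  assumes I: "finite I" and c: "c \<ge> 0"
    and two: "\<And>J j. J \<subseteq> I \<Longrightarrow> j \<in> I \<Longrightarrow> j \<notin> J \<Longrightarrow> ennreal c \<le> e J j + e (insert j J) j"
    and R: "\<And>J. J \<subseteq> I \<Longrightarrow> (\<Sum>j\<in>I. e J j) \<le> R"
  shows "ennreal (real (card I) * c / 2) \<le> R"
proof -
  \<comment> \<open>For fixed \<open>j\<close> the vertices split into pairs \<open>J\<close>,
    \<open>insert j J\<close>; there are half as many pairs as vertices, and each contributes at
    least \<open>c\<close>.\<close>
  have half: "ennreal (2 ^ card I * (c / 2)) \<le> (\<Sum>J\<in>Pow I. e J j)" if j: "j \<in> I" for j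
  proof -
    define I' where "I' = I - {j}"
    have I': "I = insert j I'" "j \<notin> I'" "finite I'" using I j by (auto simp: I'_def)
    have "ennreal (2 ^ card I * (c / 2)) = ennreal (2 ^ card I' * c)"
      using I' by simp
    also have "\<dots> = (\<Sum>J\<in>Pow I'. ennreal c)"
      using c I' by (simp add: card_Pow ennreal_mult' ennreal_power[symmetric] ennreal_of_nat_eq_real_of_nat)
    also have "\<dots> \<le> (\<Sum>J\<in>Pow I'. e J j + e (insert j J) j)"
      using I' by (intro sum_mono two) auto
    also have "\<dots> = (\<Sum>J\<in>Pow I'. e J j) + (\<Sum>J\<in>insert j ` Pow I'. e J j)"
    proof -
      have "inj_on (insert j) (Pow I')" using I'(2) by (intro inj_onI) (metis PowD insert_ident subsetD)
      then show ?thesis by (simp add: sum.distrib sum.reindex)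
    qed
    also have "\<dots> = (\<Sum>J\<in>Pow I. e J j)"
      unfolding I'(1) Pow_insert using I' by (intro sum.union_disjoint[symmetric]) auto
    finally show ?thesis .
  qed
  have "ennreal (2 ^ card I * (real (card I) * c / 2)) = (\<Sum>j\<in>I. ennreal (2 ^ card I * (c / 2)))"
    using c by (simp add: ennreal_of_nat_eq_real_of_nat ennreal_mult'[symmetric] ac_simps)
  also have "\<dots> \<le> (\<Sum>j\<in>I. \<Sum>J\<in>Pow I. e J j)" by (intro sum_mono half)
  also have "\<dots> = (\<Sum>J\<in>Pow I. \<Sum>j\<in>I. e J j)" by (rule sum.swap)
  also have "\<dots> \<le> (\<Sum>J\<in>Pow I. R)" by (intro sum_mono R) auto
  also have "\<dots> = ennreal (2 ^ card I) * R"
    using I by (simp add: card_Pow ennreal_power[symmetric])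
  finally have le: "ennreal (2 ^ card I * (real (card I) * c / 2)) \<le> ennreal (2 ^ card I) * R" .
  show ?thesis
  proof (cases R)
    case (real x)
    with le c show ?thesis by (simp add: ennreal_mult'[symmetric] del: ennreal_power)
  next
    case top
    then show ?thesis by simp
  qed
qed

section \<open>From coordinate errors to the risk\<close>

lemma nn_integral_obs_law:
  assumes W: "wiener_distribution Q" and f: "continuous_on UNIV f"
    and G: "G \<in> borel_measurable (path_space {0..T})"
  shows "(\<integral>\<^sup>+y. G (restrict y {0..T}) \<partial>obs_law f Q) = (\<integral>\<^sup>+y. G y \<partial>drift_law T f Q)"
proof -
  have r: "(\<lambda>y. restrict y {0..T}) \<in> path_space {0..} \<rightarrow>\<^sub>M path_space {0..T}"
    by (rule path_space_restrict_measurable) auto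
  have Gr: "(\<lambda>y. G (restrict y {0..T})) \<in> borel_measurable (obs_law f Q)"
    using measurable_compose[OF r G] by (simp add: obs_law_def)
  have Gd: "G \<in> borel_measurable (drift_law T f Q)"
    using G by (simp add: drift_law_def)
  have "(\<integral>\<^sup>+y. G (restrict y {0..T}) \<partial>obs_law f Q)
      = (\<integral>\<^sup>+\<xi>. G (restrict (\<lambda>t\<in>{0..}. integral {0..t} f + \<xi> t) {0..T}) \<partial>Q)"
    unfolding obs_law_def
    by (rule nn_integral_distr[OF drift_map_measurable[OF W f order_refl] Gr[unfolded obs_law_def]])
  \<comment> \<open>Restricting the full observation gives the same path as adding the drift on the
    shorter interval.\<close>
  also have "\<dots> = (\<integral>\<^sup>+\<xi>. G (\<lambda>t\<in>{0..T}. integral {0..t} f + \<xi> t) \<partial>Q)"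
    by (intro nn_integral_cong arg_cong[where f=G]) (auto simp: restrict_def)
  also have "\<dots> = (\<integral>\<^sup>+y. G y \<partial>drift_law T f Q)"
    unfolding drift_law_def
    by (rule nn_integral_distr[symmetric, OF drift_map_measurable[OF W f] Gd[unfolded drift_law_def]]) auto
  finally show ?thesis .
qed

lemma estimator_coordinate_measurable:
  assumes "T \<in> estimators n" "j \<ge> 1"
  shows "(\<lambda>y. X_inner (T y) (trig_basis j)) \<in> borel_measurable (path_space {0..real n})"
  using assms by (auto simp: estimators_def intro: measurable_compose[OF _ X_inner_trig_basis_measurable])

lemma space_X_borel: "space X_borel = X_space"
  unfolding X_borel_def by (rule space_measure_of) blast

lemma X_norm_scale_square: "(X_norm (\<lambda>t. c * h t))\<^sup>2 = c\<^sup>2 * (X_norm h)\<^sup>2"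
proof -
  have "(\<lambda>t. (c * h t) * (c * h t)) = (\<lambda>t. c\<^sup>2 * (h t * h t))" by (simp add: power2_eq_square ac_simps)
  then show ?thesis
    unfolding X_norm_square X_inner_def by (simp only: Bochner_Integration.integral_mult_right_zero)
qed

text \<open>Bessel's inequality bounds the coordinate errors by the squared norm pointwise, and the
  suprema in \<open>risk\<close> are bounded below by their values at \<open>S\<close> and
  \<open>Q\<close>. The change of measure is carried out on the finite coordinate sum
  \<open>G\<close>, whose measurability follows from that of the coordinates; the norm enters
  through monotonicity of the integral.\<close>

lemma coordinate_risk_le:
  assumes W: "wiener_distribution Q" "Q \<in> P" and T: "T \<in> estimators n"
    and S: "S \<in> Theta \<beta> r" and I: "finite I" "I \<subseteq> {1..}"
  shows "(\<Sum>j\<in>I. ennreal ((omega \<beta> n)\<^sup>2) * (\<integral>\<^sup>+y.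
      ennreal ((X_inner (T y) (trig_basis j) - X_inner S (trig_basis j))\<^sup>2) \<partial>drift_law (real n) S Q))
    \<le> risk P r \<beta> n T"
proof -
  define w where "w = omega \<beta> n"
  define v where "v j y = (X_inner (T y) (trig_basis j) - X_inner S (trig_basis j))\<^sup>2" for j y
  have SX: "S \<in> X_space" and Sc: "continuous_on UNIV S" using S by (auto simp: Theta_def)
  have v: "v j \<in> borel_measurable (path_space {0..real n})" if "j \<in> I" for j
    unfolding v_def using estimator_coordinate_measurable[OF T, of j] that I(2) by auto
  define G where "G y = (\<Sum>j\<in>I. ennreal (w\<^sup>2) * ennreal (v j y))" for y
  have G: "G \<in> borel_measurable (path_space {0..real n})"
    unfolding G_def using v by (intro borel_measurable_sum) auto
  have "(\<Sum>j\<in>I. ennreal (w\<^sup>2) * (\<integral>\<^sup>+y. ennreal (v j y) \<partial>drift_law (real n) S Q))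
      = (\<integral>\<^sup>+y. G y \<partial>drift_law (real n) S Q)"
  proof -
    have "v j \<in> borel_measurable (drift_law (real n) S Q)" if "j \<in> I" for j
      using v[OF that] by (simp add: measurable_cong_sets[OF sets_drift_law refl])
    then show ?thesis unfolding G_def by (simp add: nn_integral_sum nn_integral_cmult)
  qed
  also have "\<dots> = (\<integral>\<^sup>+y. G (restrict y {0..real n}) \<partial>obs_law S Q)"
    by (rule nn_integral_obs_law[symmetric, OF W(1) Sc G])
  also have "\<dots> \<le> (\<integral>\<^sup>+y. ennreal ((X_norm (\<lambda>t. w * (T (restrict y {0..real n}) t - S t)))\<^sup>2) \<partial>obs_law S Q)"
  proof (rule nn_integral_mono)
    fix y assume "y \<in> space (obs_law S Q)"
    then have "restrict y {0..real n} \<in> space (path_space {0..real n})"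
      by (intro measurable_space[OF path_space_restrict_measurable[of _ "{0..}"]]) (auto simp: obs_law_def)
    then have TX: "T (restrict y {0..real n}) \<in> X_space"
      using measurable_space[of T "path_space {0..real n}" X_borel] T by (auto simp: estimators_def space_X_borel)
    let ?h = "\<lambda>t. T (restrict y {0..real n}) t - S t"
    have "(\<Sum>j\<in>I. v j (restrict y {0..real n})) \<le> (X_norm ?h)\<^sup>2"
      using bessel_trig_basis[OF X_space_diff[OF TX SX] I]
      unfolding v_def X_inner_diff_trig_basis[OF TX SX] .
    then have "w\<^sup>2 * (\<Sum>j\<in>I. v j (restrict y {0..real n})) \<le> (X_norm (\<lambda>t. w * ?h t))\<^sup>2"
      unfolding X_norm_scale_square by (intro mult_left_mono) auto
    moreover have "G (restrict y {0..real n}) = ennreal (w\<^sup>2 * (\<Sum>j\<in>I. v j (restrict y {0..real n})))"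
      unfolding G_def by (simp add: sum_distrib_left[symmetric] ennreal_mult v_def sum_nonneg)
    ultimately show "G (restrict y {0..real n}) \<le> ennreal ((X_norm (\<lambda>t. w * ?h t))\<^sup>2)"
      by (simp add: ennreal_leI)
  qed
  also have "\<dots> \<le> risk P r \<beta> n T"
    unfolding risk_def w_def by (intro SUP_upper2[OF S] SUP_upper2[OF W(2)] order_refl)
  finally show ?thesis unfolding v_def w_def .
qed

lemma risk_lower_bound:
  assumes W: "wiener_distribution Q" "Q \<in> P" and T: "T \<in> estimators n" and n: "n \<ge> 1"
    and \<delta>: "\<delta> > 0" and m: "real m powr (2 * \<beta> + 1) * \<delta>\<^sup>2 \<le> r\<^sup>2" and \<beta>: "\<beta> \<ge> 0"
  shows "ennreal (real m * ((omega \<beta> n)\<^sup>2 * \<delta>\<^sup>2 / (16 * exp (2 * \<delta>\<^sup>2 * real n))) / 2) \<le> risk P r \<beta> n T"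
proof -
  \<comment> \<open>This is \<open>exp (B\<^sup>2 * T)\<close> for the drift distance
    \<open>B = \<delta> * sqrt 2\<close> and the time horizon \<open>T = n\<close>.\<close>
  define K where "K = exp (2 * \<delta>\<^sup>2 * real n)"
  have K: "K \<ge> 1" by (simp add: K_def)
  define w where "w = (omega \<beta> n)\<^sup>2"
  define u where "u j y = X_inner (T y) (trig_basis j)" for j y
  define L where "L J = drift_law (real n) (trig_sum \<delta> J) Q" for J
  \<comment> \<open>The true coordinate of the signal is \<open>\<delta>\<close> or \<open>0\<close>
    according to whether \<open>j \<in> J\<close>, so neighbouring vertices fit the two-point
    bound.\<close>
  define e where "e J j = ennreal w * (\<integral>\<^sup>+y. ennreal ((u j y - (if j \<in> J then \<delta> else 0))\<^sup>2) \<partial>L J)" for J j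
  have "ennreal (real (card {1..m}) * (w * (\<delta>\<^sup>2 / (16 * K))) / 2) \<le> risk P r \<beta> n T"
  proof (rule assouad[where e=e])
    show "w * (\<delta>\<^sup>2 / (16 * K)) \<ge> 0" using K by (simp add: w_def)
    fix J assume J: "J \<subseteq> {1..m}"
    then have J': "finite J" "J \<subseteq> {1..}" using finite_subset by auto
    have "(\<Sum>j\<in>{1..m}. e J j) = (\<Sum>j\<in>{1..m}. ennreal w * (\<integral>\<^sup>+y.
        ennreal ((X_inner (T y) (trig_basis j) - X_inner (trig_sum \<delta> J) (trig_basis j))\<^sup>2) \<partial>L J))"
      unfolding e_def u_def by (intro sum.cong refl) (simp add: X_inner_trig_sum[OF J'])
    also have "\<dots> \<le> risk P r \<beta> n T"
      unfolding L_def w_def by (rule coordinate_risk_le[OF W T trig_sum_in_Theta[OF J m \<beta>]]) auto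
    finally show "(\<Sum>j\<in>{1..m}. e J j) \<le> risk P r \<beta> n T" .
  next
    fix J j assume J: "J \<subseteq> {1..m}" and j: "j \<in> {1..m}" "j \<notin> J"
    have fJ: "finite J" using J finite_subset by auto
    have ps: "prob_space (L J)" for J
      unfolding L_def by (rule prob_space_drift_law[OF W(1) continuous_on_trig_sum])
    have sL: "sets (L J) = sets (path_space {0..real n})" for J by (simp add: L_def)
    have u: "u j \<in> borel_measurable (L J)"
      unfolding u_def using estimator_coordinate_measurable[OF T, of j] j
      by (simp add: measurable_cong_sets[OF sL refl])
    have diff: "\<bar>trig_sum \<delta> (insert j J) t - trig_sum \<delta> J t\<bar> \<le> \<delta> * sqrt 2" for t
      using fJ j \<delta> abs_trig_basis_le[of j t] by (simp add: trig_sum_def abs_mult)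
    have "(measure (L (insert j J)) A)\<^sup>2 \<le> exp ((\<delta> * sqrt 2)\<^sup>2 * real n) * measure (L J) A"
      if "A \<in> sets (L J)" for A
      unfolding L_def using that n
      by (intro drift_law_measure_sq_le[OF W(1) _ continuous_on_trig_sum continuous_on_trig_sum diff]) (auto simp: sL)
    then have le: "(measure (L (insert j J)) A)\<^sup>2 \<le> K * measure (L J) A" if "A \<in> sets (L J)" for A
      using that by (simp add: K_def power_mult_distrib mult.commute)
    have "ennreal (w * (\<delta>\<^sup>2 / (16 * K))) = ennreal w * ennreal (\<delta>\<^sup>2 / (16 * K))"
      by (rule ennreal_mult') (simp add: w_def)
    also have "\<dots> \<le> ennreal w * ((\<integral>\<^sup>+y. ennreal ((u j y)\<^sup>2) \<partial>L J)
        + (\<integral>\<^sup>+y. ennreal ((u j y - \<delta>)\<^sup>2) \<partial>L (insert j J)))"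
      by (intro mult_left_mono two_point_bound[OF ps ps _ u \<delta> K le]) (simp_all add: sL)
    also have "\<dots> = e J j + e (insert j J) j"
      using j by (simp add: e_def distrib_left)
    finally show "ennreal (w * (\<delta>\<^sup>2 / (16 * K))) \<le> e J j + e (insert j J) j" .
  qed simp
  then show ?thesis by (simp add: K_def w_def)
qed

theorem theorem4:
  fixes r \<kappa> \<beta> :: real
    and P :: "(real \<Rightarrow> real) measure set"
    and Q\<^sub>0 :: "(real \<Rightarrow> real) measure"
    and lamstar :: "(real \<Rightarrow> real) measure \<Rightarrow> real"
  assumes "r > 0"
    and noise: "\<And>Q. Q \<in> P \<Longrightarrow> noise_distribution Q"
    and wiener: "wiener_distribution Q\<^sub>0" "Q\<^sub>0 \<in> P"
    and gauss: "\<And>Q n k. Q \<in> P \<Longrightarrow> n \<ge> 1 \<Longrightarrow> k \<ge> 1 \<Longrightarrow>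
                  gaussian_family Q {1..k} (zeta Q n) \<and> invertible_mat (cov_mat Q k n)"
    and eig_bound: "\<And>Q. Q \<in> P \<Longrightarrow>
                  (SUP k\<in>{1..}. SUP n\<in>{1..}. ereal (lambda_max (cov_mat Q k n))) \<le> ereal (lamstar Q)"
    and lamstar_bound: "\<And>Q. Q \<in> P \<Longrightarrow> lamstar Q \<le> \<kappa>"
    and "\<beta> \<ge> 1"
  shows "liminf (\<lambda>n. INF T\<in>estimators n. risk P r \<beta> n T) > 0"
proof -
  \<comment> \<open>The factor 64 collects 16 from the two-point bound, 2 from averaging over the
    cube and 2 from rounding \<open>a\<close> down to \<open>m\<close>.\<close>
  define c where "c = r\<^sup>2 / (64 * exp (2 * r\<^sup>2))"
  have c: "c > 0" using \<open>r > 0\<close> by (simp add: c_def)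
  have "ennreal c \<le> risk P r \<beta> n T" if n: "n \<ge> 1" and T: "T \<in> estimators n" for n T
  proof -
    define a where "a = real n powr (1 / (2 * \<beta> + 1))"
    define m where "m = nat \<lfloor>a\<rfloor>"
    \<comment> \<open>This height makes \<open>\<delta>\<^sup>2 * n\<close> equal to
      \<open>r\<^sup>2\<close>: the factor between neighbouring laws is free of \<open>n\<close>,
      and the cube just fits into the class.\<close>
    define \<delta> where "\<delta> = r / sqrt (real n)"
    have \<delta>: "\<delta> > 0" using \<open>r > 0\<close> n by (simp add: \<delta>_def)
    have \<delta>2: "\<delta>\<^sup>2 * real n = r\<^sup>2" using n by (simp add: \<delta>_def power_divide)
    have a: "a \<ge> 1" unfolding a_def using n \<open>\<beta> \<ge> 1\<close> by (intro ge_one_powr_ge_zero) auto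
    \<comment> \<open>As \<open>a \<ge> 1\<close>, rounding down loses at most a factor of
      2.\<close>
    have "1 \<le> \<lfloor>a\<rfloor>" using a by simp
    then have "real m = real_of_int \<lfloor>a\<rfloor>" "1 \<le> real m" unfolding m_def by simp_all
    then have m: "real m \<le> a" "a / 2 \<le> real m" by linarith+
    have "real m powr (2 * \<beta> + 1) \<le> a powr (2 * \<beta> + 1)"
      using m(1) \<open>\<beta> \<ge> 1\<close> by (intro powr_mono2) auto
    also have "\<dots> = real n" using n \<open>\<beta> \<ge> 1\<close> by (simp add: a_def powr_powr)
    finally have "real m powr (2 * \<beta> + 1) * \<delta>\<^sup>2 \<le> real n * \<delta>\<^sup>2" by (rule mult_right_mono) simp
    then have mr: "real m powr (2 * \<beta> + 1) * \<delta>\<^sup>2 \<le> r\<^sup>2" using \<delta>2 by (simp add: mult.commute)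
    \<comment> \<open>The rate balances here: the exponents of \<open>n\<close> in
      \<open>\<omega>\<^sub>n\<^sup>2\<close> and in the number of coordinates add up to 1, which
      cancels the \<open>1 / n\<close> in \<open>\<delta>\<^sup>2\<close>.\<close>
    have "(omega \<beta> n)\<^sup>2 * a = real n powr (2 * (\<beta> / (2 * \<beta> + 1)) + 1 / (2 * \<beta> + 1))"
      unfolding omega_def a_def power2_eq_square powr_add[symmetric] by simp
    also have "2 * (\<beta> / (2 * \<beta> + 1)) + 1 / (2 * \<beta> + 1) = 1"
      using \<open>\<beta> \<ge> 1\<close> by (simp add: add_divide_distrib[symmetric])
    finally have "(omega \<beta> n)\<^sup>2 * a * \<delta>\<^sup>2 = r\<^sup>2" using \<delta>2 n by (simp add: mult.commute)
    moreover have "(omega \<beta> n)\<^sup>2 * (a / 2) * \<delta>\<^sup>2 \<le> (omega \<beta> n)\<^sup>2 * real m * \<delta>\<^sup>2"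
      using m(2) by (intro mult_right_mono mult_left_mono) auto
    ultimately have "r\<^sup>2 / 2 \<le> (omega \<beta> n)\<^sup>2 * real m * \<delta>\<^sup>2" by simp
    then have "r\<^sup>2 / 2 / (32 * exp (2 * r\<^sup>2)) \<le> (omega \<beta> n)\<^sup>2 * real m * \<delta>\<^sup>2 / (32 * exp (2 * r\<^sup>2))"
      by (rule divide_right_mono) simp
    then have "c \<le> real m * ((omega \<beta> n)\<^sup>2 * \<delta>\<^sup>2 / (16 * exp (2 * \<delta>\<^sup>2 * real n))) / 2"
      by (simp add: c_def \<delta>2 mult.assoc) (simp add: ac_simps)
    then have "ennreal c \<le> ennreal (real m * ((omega \<beta> n)\<^sup>2 * \<delta>\<^sup>2 / (16 * exp (2 * \<delta>\<^sup>2 * real n))) / 2)"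
      by (rule ennreal_leI)
    also have "\<dots> \<le> risk P r \<beta> n T"
      using \<open>\<beta> \<ge> 1\<close> by (intro risk_lower_bound[OF wiener T n \<delta> mr]) simp
    finally show ?thesis .
  qed
  \<comment> \<open>\<open>c\<close> depends neither on the estimator nor on \<open>n\<close>, so
    the bound survives the infimum and the lower limit.\<close>
  then have "eventually (\<lambda>n. ennreal c \<le> (INF T\<in>estimators n. risk P r \<beta> n T)) sequentially"
    by (intro eventually_sequentiallyI[of 1] INF_greatest)
  then have "ennreal c \<le> liminf (\<lambda>n. INF T\<in>estimators n. risk P r \<beta> n T)"
    by (rule Liminf_bounded)
  moreover have "0 < ennreal c" using c by simp
  ultimately show ?thesis by (rule less_le_trans[rotated])
qed

end
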